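(* Let $\mathcal{M}=(E,\mathcal{I})$ be a loopless uniformly dense matroid with $n=|E|$ elements and rank $r\geq 1$, and let $p\in(0,1)$. Consider the matroid secretary problem on $\mathcal{M}$ in the random assignment model with adversarial weights $w_1\geq w_2\geq\dots\geq w_n\geq 0$, and let $\mathrm{ALG}$ be the set returned by the following algorithm: maintain a set $T$ containing the $r$ heaviest elements seen so far (initialized with $r$ dummy elements considered lighter than every real element); set $\mathrm{ALG}=\emptyset$; draw $m$ from the binomial distribution $\mathrm{Bin}(n,p)$; observe the first $m$ arriving elements (the sample) without accepting any; for each later arriving element $e$, if $e$ enters $T$ and the element leaving $T$ is in the sample or is a dummy element, then add $e$ to $\mathrm{ALG}$ provided $\mathrm{ALG}\cup\{e\}$ is independent; finally return $\mathrm{ALG}$. Then $$\mathbb{E}_{\sigma,\pi}[w(\mathrm{ALG})]\geq(-p^2\ln p)\sum_{i=1}^r w_i\geq(-p^2\ln p)\,\mathbb{E}_\sigma[w(\mathrm{OPT}_{\mathcal{M}}(\sigma))].$$ In particular, with $p=e^{-1/2}$ this algorithm is $2e$-competitive for uniformly dense matroids in the random assignment model.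
   Context: A loopless matroid $\mathcal{M}=(E,\mathcal{I})$ with rank function $r(\cdot)$ is uniformly dense if $|X|/r(X)\leq |E|/r(E)$ for every non-empty $X\subseteq E$. Random assignment model: write $E=\{e_1,\dots,e_n\}$; an adversary chooses nonnegative weights $w_1\geq\dots\geq w_n\geq 0$; a uniformly random permutation $\sigma$ of $[n]$ assigns weights by $w(e_{\sigma(i)})=w_i$; independently, the elements are revealed to the online algorithm in a uniformly random order $\pi$. When an element is revealed the algorithm only learns the relative order of its weight with respect to previously revealed weights (ties broken by an independent uniformly random permutation), and must irrevocably decide whether to accept it, keeping the accepted set independent at all times. $\mathrm{OPT}_{\mathcal{M}}(\sigma)$ denotes the set obtained by the greedy procedure (select an element if it keeps the selected set independent) applied to $e_{\sigma(1)},e_{\sigma(2)},\dots,e_{\sigma(n)}$; it is a maximum-weight independent set. An algorithm returning $\mathrm{ALG}$ is $\alpha$-competitive if $\alpha\,\mathbb{E}_{\pi,\sigma}[w(\mathrm{ALG})]\geq\mathbb{E}_\sigma[w(\mathrm{OPT}(\sigma))]$ for every choice of adversarial weights. For a set $S$, $w(S)=\sum_{e\in S}w(e)$. *)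

theory Defs
  imports "HOL-Probability.Probability" "HOL-Combinatorics.Multiset_Permutations"
begin

definition matroid :: "'a set \<Rightarrow> ('a set \<Rightarrow> bool) \<Rightarrow> bool" where
  "matroid E indep \<longleftrightarrow> finite E \<and> indep {} \<and> (\<forall>A. indep A \<longrightarrow> A \<subseteq> E)
     \<and> (\<forall>A B. indep A \<and> B \<subseteq> A \<longrightarrow> indep B)
     \<and> (\<forall>A B. indep A \<and> indep B \<and> card A < card B \<longrightarrow> (\<exists>x\<in>B - A. indep (insert x A)))"

definition mrank :: "('a set \<Rightarrow> bool) \<Rightarrow> 'a set \<Rightarrow> nat" where
  "mrank indep X = Max {card A | A. A \<subseteq> X \<and> indep A}"

definition loopless :: "'a set \<Rightarrow> ('a set \<Rightarrow> bool) \<Rightarrow> bool" where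
  "loopless E indep \<longleftrightarrow> (\<forall>e\<in>E. indep {e})"

definition uniformly_dense :: "'a set \<Rightarrow> ('a set \<Rightarrow> bool) \<Rightarrow> bool" where
  "uniformly_dense E indep \<longleftrightarrow> (\<forall>X. X \<subseteq> E \<and> X \<noteq> {} \<longrightarrow>
     real (card X) / real (mrank indep X) \<le> real (card E) / real (mrank indep E))"

definition pos :: "'a list \<Rightarrow> 'a \<Rightarrow> nat" where
  "pos xs x = (LEAST i. i < length xs \<and> xs ! i = x)"

text \<open>The assignment sigma is a list enumerating E: the element sigma!(i-1) receives weight w i
  (weights indexed 1..n), i.e. element e gets weight w (pos sigma e + 1).\<close>
definition wt :: "(nat \<Rightarrow> real) \<Rightarrow> 'a list \<Rightarrow> 'a \<Rightarrow> real" where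
  "wt w \<sigma> e = w (pos \<sigma> e + 1)"

text \<open>Strict total order of elements used by the algorithm: by weight, ties broken by
  the independent uniformly random permutation tau (earlier in tau = heavier).\<close>
definition heavier :: "(nat \<Rightarrow> real) \<Rightarrow> 'a list \<Rightarrow> 'a list \<Rightarrow> 'a \<Rightarrow> 'a \<Rightarrow> bool" where
  "heavier w \<sigma> \<tau> x y \<longleftrightarrow> wt w \<sigma> x > wt w \<sigma> y \<or> (wt w \<sigma> x = wt w \<sigma> y \<and> pos \<tau> x < pos \<tau> y)"

definition greedy :: "('a set \<Rightarrow> bool) \<Rightarrow> 'a list \<Rightarrow> 'a set" where
  "greedy indep xs = fold (\<lambda>e A. if indep (insert e A) then insert e A else A) xs {}"

text \<open>Processing of the arrival at time t (0-based) of element pi!t, with sample size m.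
  S is the set of elements seen before; T consists of the r heaviest elements of S,
  padded with dummies. The element e enters T iff fewer than r elements of S are heavier;
  the element leaving T is a dummy if |S| < r, and otherwise the unique x in S with exactly
  r-1 elements of S heavier than x.\<close>
definition alg_step :: "('a set \<Rightarrow> bool) \<Rightarrow> nat \<Rightarrow> ('a \<Rightarrow> 'a \<Rightarrow> bool) \<Rightarrow> 'a list \<Rightarrow> nat
    \<Rightarrow> nat \<Rightarrow> 'a set \<Rightarrow> 'a set" where
  "alg_step indep r hv \<pi> m t A =
     (let e = \<pi> ! t; S = set (take t \<pi>) in
      if card {x\<in>S. hv x e} < r \<and>
         (card S < r \<or> (\<exists>x\<in>S. card {y\<in>S. hv y x} = r - 1 \<and> x \<in> set (take m \<pi>)))
      then (if indep (insert e A) then insert e A else A) else A)"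

definition alg :: "('a set \<Rightarrow> bool) \<Rightarrow> nat \<Rightarrow> ('a \<Rightarrow> 'a \<Rightarrow> bool) \<Rightarrow> 'a list \<Rightarrow> nat \<Rightarrow> 'a set" where
  "alg indep r hv \<pi> m = fold (alg_step indep r hv \<pi> m) [m..<length \<pi>] {}"

definition exp_alg :: "'a set \<Rightarrow> ('a set \<Rightarrow> bool) \<Rightarrow> (nat \<Rightarrow> real) \<Rightarrow> real \<Rightarrow> real" where
  "exp_alg E indep w p =
     measure_pmf.expectation
       (pair_pmf (binomial_pmf (card E) p)
         (pair_pmf (pmf_of_set (permutations_of_set E))
           (pair_pmf (pmf_of_set (permutations_of_set E)) (pmf_of_set (permutations_of_set E)))))
       (\<lambda>(m, \<sigma>, \<tau>, \<pi>). \<Sum>e\<in>alg indep (mrank indep E) (heavier w \<sigma> \<tau>) \<pi> m. wt w \<sigma> e)"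

definition exp_opt :: "'a set \<Rightarrow> ('a set \<Rightarrow> bool) \<Rightarrow> (nat \<Rightarrow> real) \<Rightarrow> real" where
  "exp_opt E indep w =
     measure_pmf.expectation (pmf_of_set (permutations_of_set E))
       (\<lambda>\<sigma>. \<Sum>e\<in>greedy indep \<sigma>. wt w \<sigma> e)"

end

theory Submission
  imports Defs
begin

text \<open>
  Call an arrival selected if it enters \<open>T\<close> and replaces a sample element or a dummy; the selected
  sequence does not depend on the matroid. Relabelling the ground set by an independent uniformly
  random permutation does not change the law of the input, so the selected elements may be regarded
  as uniformly random distinct elements of \<open>E\<close>. Uniform density bounds the span of \<open>k\<close> elements by
  \<open>k n / r\<close>, hence an element selected after \<open>k\<close> others is accepted with probability at least
  \<open>1 - k / r\<close>. Moreover \<open>k\<close> is at most the number of elements of \<open>T\<close> from outside the sample.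

  Let one of the \<open>r\<close> heaviest elements arrive after \<open>s \<ge> r\<close> others, and let \<open>Y\<close> be the number of sample
  elements in \<open>T\<close>. Transposing elements of \<open>T\<close> in the arrival order shows that the element leaving
  \<open>T\<close> contributes the mean of \<open>(Y / r)\<^sup>2\<close>, which is at least the mean of \<open>2 p Y / r - p\<^sup>2\<close>; and
  \<open>Y / r\<close> has mean \<open>m / s\<close>. The case \<open>s < r\<close> satisfies the same bound. Averaging \<open>m / s\<close> over \<open>s\<close> and
  the binomial \<open>m\<close> gives at least \<open>- p ln p\<close>, and the resulting \<open>- 2 p\<^sup>2 ln p - p\<^sup>2 (1 - p)\<close> is at least
  \<open>- p\<^sup>2 ln p\<close> because \<open>ln p \<le> p - 1\<close>.
\<close>

subsection \<open>Spans in uniformly dense matroids\<close>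

definition mspan :: "'a set \<Rightarrow> ('a set \<Rightarrow> bool) \<Rightarrow> 'a set \<Rightarrow> 'a set" where
  "mspan E indep X = {e\<in>E. mrank indep (insert e X) = mrank indep X}"

context
  fixes E :: "'a set" and indep :: "'a set \<Rightarrow> bool"
  assumes mat: "matroid E indep"
begin

lemma finite_E: "finite E"
  using mat by (simp add: matroid_def)

lemma indep_subset: "indep A \<Longrightarrow> B \<subseteq> A \<Longrightarrow> indep B"
  using mat unfolding matroid_def by blast

lemma indep_carrier: "indep A \<Longrightarrow> A \<subseteq> E"
  using mat unfolding matroid_def by blast

lemma indep_finite: "indep A \<Longrightarrow> finite A"
  by (rule finite_subset[OF indep_carrier finite_E])

lemma augment: "indep A \<Longrightarrow> indep B \<Longrightarrow> card A < card B \<Longrightarrow> \<exists>x\<in>B - A. indep (insert x A)"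
  using mat unfolding matroid_def by blast

lemma finite_rank_set: "finite {card A | A. A \<subseteq> X \<and> indep A}"
proof (rule finite_subset)
  show "{card A | A. A \<subseteq> X \<and> indep A} \<subseteq> card ` Pow E"
    using indep_carrier by blast
qed (simp add: finite_E)

lemma card_le_mrank: "A \<subseteq> X \<Longrightarrow> indep A \<Longrightarrow> card A \<le> mrank indep X"
  unfolding mrank_def by (rule Max_ge[OF finite_rank_set]) blast

lemma obtain_basis:
  obtains A where "A \<subseteq> X" "indep A" "card A = mrank indep X"
proof -
  have "mrank indep X \<in> {card A | A. A \<subseteq> X \<and> indep A}"
    unfolding mrank_def
  proof (rule Max_in[OF finite_rank_set])
    have "indep {}" using mat by (simp add: matroid_def)
    then show "{card A | A. A \<subseteq> X \<and> indep A} \<noteq> {}" by blast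
  qed
  then show ?thesis using that by auto
qed

lemma mrank_mono: "X \<subseteq> Y \<Longrightarrow> mrank indep X \<le> mrank indep Y"
  by (metis obtain_basis card_le_mrank order_trans)

lemma mrank_le_card: "finite X \<Longrightarrow> mrank indep X \<le> card X"
  by (metis obtain_basis card_mono)

lemma subset_mspan: "X \<subseteq> E \<Longrightarrow> X \<subseteq> mspan E indep X"
  by (auto simp: mspan_def insert_absorb)

text \<open>Otherwise exchange would extend a basis \<open>A\<close> of \<open>X\<close> by an
  element \<open>x\<close> of the span, and \<open>insert x A\<close> would witness that
  \<open>x\<close> raises the rank of \<open>X\<close>.\<close>

lemma mrank_mspan_le: "mrank indep (mspan E indep X) \<le> mrank indep X"
proof (rule ccontr)
  assume less: "\<not> ?thesis"
  obtain B where B: "B \<subseteq> mspan E indep X" "indep B" "card B = mrank indep (mspan E indep X)"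
    by (rule obtain_basis)
  obtain A where A: "A \<subseteq> X" "indep A" "card A = mrank indep X"
    by (rule obtain_basis)
  obtain x where x: "x \<in> B - A" "indep (insert x A)"
    using augment[OF A(2) B(2)] less A B by auto
  have "finite A" using A(2) by (rule indep_finite)
  then have "Suc (mrank indep X) = card (insert x A)" using x A by simp
  also have "\<dots> \<le> mrank indep (insert x X)" using x A by (intro card_le_mrank) auto
  finally show False using x(1) B(1) by (auto simp: mspan_def)
qed

text \<open>The set \<open>A\<close> may be smaller than a basis of \<open>X\<close>, so it is first
  enlarged to a largest independent \<open>B\<close> between \<open>A\<close> and \<open>X\<close>.
  A basis \<open>D\<close> of \<open>insert e X\<close> is larger than \<open>B\<close>, and by
  maximality the element of \<open>D\<close> that exchange adds to \<open>B\<close> can only be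
  \<open>e\<close>.\<close>

lemma indep_insert_not_mspan:
  assumes "e \<in> E - mspan E indep X" "A \<subseteq> X" "indep A"
  shows "indep (insert e A)"
proof -
  let ?P = "\<lambda>B. A \<subseteq> B \<and> B \<subseteq> X \<and> indep B"
  have "\<forall>B. ?P B \<longrightarrow> card B < Suc (card E)"
    using indep_carrier finite_E by (simp add: card_mono less_Suc_eq_le)
  then obtain B where B: "?P B" "\<And>C. ?P C \<Longrightarrow> card C \<le> card B"
    using ex_has_greatest_nat[of ?P A card "Suc (card E)"] assms by blast
  obtain D where D: "D \<subseteq> insert e X" "indep D" "card D = mrank indep (insert e X)"
    by (rule obtain_basis)
  have "card B \<le> mrank indep X" using B by (intro card_le_mrank) auto
  moreover have "mrank indep X < mrank indep (insert e X)"
    using assms(1) mrank_mono[OF subset_insertI, of X e] by (auto simp: mspan_def)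
  ultimately have "card B < card D" using D(3) by linarith
  then obtain x where x: "x \<in> D - B" "indep (insert x B)"
    using augment[of B D] B(1) D(2) by blast
  have "finite B" using B(1) indep_finite by simp
  then have "card (insert x B) = Suc (card B)" using x by simp
  then have "x \<notin> X" using B(2)[of "insert x B"] B(1) x by auto
  then have "x = e" using x D by auto
  then show ?thesis using x(2) B(1) by (auto intro: indep_subset)
qed

text \<open>Uniform density is applied to the span itself, whose rank is at most
  \<open>card X\<close>. Looplessness makes the rank of a nonempty span positive, so that the
  density quotient is a genuine one.\<close>

lemma card_mspan_le:
  assumes "loopless E indep" "uniformly_dense E indep" "mrank indep E \<ge> 1" "X \<subseteq> E"
  shows "real (card (mspan E indep X)) \<le> real (card X) * real (card E) / real (mrank indep E)"
proof (cases "mspan E indep X = {}")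
  case False
  let ?S = "mspan E indep X"
  have sub: "?S \<subseteq> E" by (auto simp: mspan_def)
  obtain x where x: "x \<in> ?S" using False by blast
  then have "indep {x}" using assms(1) sub by (auto simp: loopless_def)
  then have pos: "mrank indep ?S \<ge> 1" using card_le_mrank[of "{x}" ?S] x by simp
  have "real (card ?S) / real (mrank indep ?S) \<le> real (card E) / real (mrank indep E)"
    using assms(2) sub False unfolding uniformly_dense_def by blast
  then have "real (card ?S) \<le> real (mrank indep ?S) * (real (card E) / real (mrank indep E))"
    using pos by (simp add: field_simps)
  also have "\<dots> \<le> real (card X) * (real (card E) / real (mrank indep E))"
  proof (rule mult_right_mono)
    show "real (mrank indep ?S) \<le> real (card X)"
      using mrank_mspan_le[of X] mrank_le_card[of X] assms(4) finite_E finite_subset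
      by (metis of_nat_le_iff order_trans)
  qed simp
  finally show ?thesis by simp
qed simp

text \<open>Composing the relabelling with a transposition of \<open>c\<close> and \<open>d\<close> fixes \<open>C\<close>, so all elements outside
  \<open>C\<close> are equally likely to be sent into the span of the image of \<open>C\<close>.\<close>
lemma card_permutations_not_mspan:
  assumes "loopless E indep" "uniformly_dense E indep" "mrank indep E \<ge> 1"
    and C: "C \<subseteq> E" and c: "c \<in> E - C"
  shows "(\<Sum>\<phi> | \<phi> permutes E. of_bool (\<phi> c \<notin> mspan E indep (\<phi> ` C)) :: real)
    \<ge> fact (card E) * (1 - real (card C) / real (mrank indep E))"
proof -
  let ?n = "card E" and ?r = "mrank indep E"
  let ?N = "\<lambda>d. \<Sum>\<phi> | \<phi> permutes E. of_bool (\<phi> d \<notin> mspan E indep (\<phi> ` C)) :: real"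
  have finC: "finite C" using C finite_E finite_subset by blast
  have sym: "?N d = ?N c" if d: "d \<in> E - C" for d
  proof -
    let ?t = "Transposition.transpose c d"
    show ?thesis
    proof (rule sum.reindex_bij_witness[where i = "\<lambda>\<phi>. \<phi> \<circ> ?t" and j = "\<lambda>\<phi>. \<phi> \<circ> ?t"])
      fix \<phi> assume "\<phi> \<in> {\<phi>. \<phi> permutes E}"
      moreover have "?t permutes E" using c d by (intro permutes_swap_id) auto
      ultimately show "\<phi> \<circ> ?t \<in> {\<phi>. \<phi> permutes E}" by (auto intro: permutes_compose)
      then show "\<phi> \<circ> ?t \<in> {\<phi>. \<phi> permutes E}" .
      show "\<phi> \<circ> ?t \<circ> ?t = \<phi>" "\<phi> \<circ> ?t \<circ> ?t = \<phi>"
        by (simp_all add: comp_assoc)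
      have "?t ` C = id ` C"
        using c d by (intro image_cong) (auto simp: Transposition.transpose_def)
      then have "(\<phi> \<circ> ?t) ` C = \<phi> ` C" by (simp add: image_comp [symmetric] del: comp_apply o_apply)
      then show "of_bool ((\<phi> \<circ> ?t) c \<notin> mspan E indep ((\<phi> \<circ> ?t) ` C))
        = (of_bool (\<phi> d \<notin> mspan E indep (\<phi> ` C)) :: real)"
        by simp
    qed
  qed
  \<comment> \<open>Double counting of the pairs of a relabelling and an element outside
    \<open>C\<close> that it sends outside the span.\<close>
  have "(real ?n - real (card C)) * ?N c = (\<Sum>d\<in>E - C. ?N c)"
    using finC C finite_E by (simp add: card_Diff_subset card_mono of_nat_diff)
  also have "\<dots> = (\<Sum>d\<in>E - C. ?N d)"
    by (rule sum.cong[OF refl sym[symmetric]])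
  also have "\<dots> = (\<Sum>\<phi> | \<phi> permutes E. \<Sum>d\<in>E - C. of_bool (\<phi> d \<notin> mspan E indep (\<phi> ` C)))"
    by (rule sum.swap)
  also have "\<dots> \<ge> (\<Sum>\<phi> | \<phi> permutes E. real ?n - real (card C) * real ?n / real ?r)"
  proof (rule sum_mono)
    fix \<phi> assume "\<phi> \<in> {\<phi>. \<phi> permutes E}"
    then have \<phi>: "\<phi> permutes E" by simp
    let ?S = "mspan E indep (\<phi> ` C)"
    have img: "\<phi> ` C \<subseteq> E" using \<phi> C permutes_image by blast
    have sub: "?S \<subseteq> E" by (auto simp: mspan_def)
    have inj: "inj_on \<phi> A" for A using \<phi> permutes_inj_on by blast
    \<comment> \<open>Since \<open>\<phi>\<close> sends \<open>C\<close> into the span of its image,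
      letting \<open>d\<close> range over all of \<open>E\<close> adds no element.\<close>
    have "{d\<in>E - C. \<phi> d \<notin> ?S} = {d\<in>E. \<phi> d \<notin> ?S}"
      using subset_mspan[OF img] by blast
    moreover have "\<phi> ` {d\<in>E. \<phi> d \<notin> ?S} = E - ?S"
      using permutes_image[OF \<phi>] by auto
    ultimately have "card {d\<in>E - C. \<phi> d \<notin> ?S} = card (E - ?S)"
      using card_image[OF inj, of "{d\<in>E. \<phi> d \<notin> ?S}"] by simp
    also have "real \<dots> = real ?n - real (card ?S)"
      using sub finite_E by (simp add: card_Diff_subset card_mono of_nat_diff finite_subset)
    also have "\<dots> \<ge> real ?n - real (card C) * real ?n / real ?r"
      using card_mspan_le[OF assms(1-3) img] by (simp add: card_image[OF inj])
    finally show "real ?n - real (card C) * real ?n / real ?r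
       \<le> (\<Sum>d\<in>E - C. of_bool (\<phi> d \<notin> ?S))"
      using finite_E by (simp add: sum_of_bool_eq Int_def conj_commute)
  qed
  finally have main: "(real ?n - real (card C)) * ?N c \<ge>
      fact ?n * (real ?n - real (card C) * real ?n / real ?r)"
    by (simp add: card_permutations[OF refl finite_E])
  \<comment> \<open>For \<open>card C > r\<close> the claimed bound is not positive. Otherwise its
    factor \<open>1 - card C / r\<close> is nonnegative, and enlarging \<open>n - card C\<close> to
    \<open>n\<close> gives the quantity just bounded; then \<open>n - card C > 0\<close>
    cancels.\<close>
  show ?thesis
  proof (cases "card C \<le> ?r")
    case False
    then have "1 - real (card C) / real ?r \<le> 0" using assms(3) by (simp add: field_simps)
    then have "fact ?n * (1 - real (card C) / real ?r) \<le> 0" by (simp add: mult_nonneg_nonpos)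
    also have "0 \<le> ?N c" by (simp add: sum_nonneg)
    finally show ?thesis .
  next
    case True
    have "card C < ?n" using C c finite_E by (intro psubset_card_mono) auto
    have nn: "0 \<le> 1 - real (card C) / real ?r" using assms(3) True by (simp add: field_simps)
    have "(real ?n - real (card C)) * (fact ?n * (1 - real (card C) / real ?r))
      \<le> real ?n * (fact ?n * (1 - real (card C) / real ?r))"
      using nn by (intro mult_right_mono) auto
    also have "\<dots> = fact ?n * (real ?n - real (card C) * real ?n / real ?r)"
      by (simp add: algebra_simps)
    also note main
    finally show ?thesis using \<open>card C < ?n\<close> by simp
  qed
qed

end

subsection \<open>Averages over the binomial sample size\<close>

text \<open>Size biasing by the absorption identity: the weight \<open>m\<close> turns
  \<open>Suc n\<close> trials into one forced success and \<open>n\<close> free trials.\<close>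

lemma binomial_mean_Suc:
  fixes p :: real
  shows "(\<Sum>m\<le>Suc n. real (Suc n choose m) * p ^ m * (1 - p) ^ (Suc n - m) * (real m * g m))
    = real (Suc n) * p * (\<Sum>m\<le>n. real (n choose m) * p ^ m * (1 - p) ^ (n - m) * g (Suc m))"
proof -
  have "real (Suc n choose Suc m) * real (Suc m) = real (Suc n) * real (n choose m)" for m
    by (metis Suc_times_binomial mult.commute of_nat_mult)
  then have "p ^ Suc m * (1 - p) ^ (n - m) * g (Suc m) * (real (Suc n choose Suc m) * real (Suc m))
     = p ^ Suc m * (1 - p) ^ (n - m) * g (Suc m) * (real (Suc n) * real (n choose m))" for m
    by (rule arg_cong)
  then have "real (Suc n choose Suc m) * p ^ Suc m * (1 - p) ^ (n - m) * (real (Suc m) * g (Suc m))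
     = real (Suc n) * p * (real (n choose m) * p ^ m * (1 - p) ^ (n - m) * g (Suc m))" for m
    by (simp only: mult_ac power_Suc)
  then have "(\<Sum>m\<le>n. real (Suc n choose Suc m) * p ^ Suc m * (1 - p) ^ (n - m) * (real (Suc m) * g (Suc m)))
     = real (Suc n) * p * (\<Sum>m\<le>n. real (n choose m) * p ^ m * (1 - p) ^ (n - m) * g (Suc m))"
    unfolding sum_distrib_left by (intro sum.cong refl)
  then show ?thesis
    unfolding sum.atMost_Suc_shift by simp
qed

text \<open>Conditioning on one of the trials, in the form of Pascal's rule.\<close>

lemma binomial_sum_Suc:
  fixes p :: real
  shows "(\<Sum>m\<le>Suc n. real (Suc n choose m) * p ^ m * (1 - p) ^ (Suc n - m) * g m)
    = (1 - p) * (\<Sum>m\<le>n. real (n choose m) * p ^ m * (1 - p) ^ (n - m) * g m)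
      + p * (\<Sum>m\<le>n. real (n choose m) * p ^ m * (1 - p) ^ (n - m) * g (Suc m))"
proof -
  have "(\<Sum>m\<le>n. real (n choose m) * p ^ m * (1 - p) ^ (n - m) * g m) * (1 - p) =
    (\<Sum>m\<le>n. real (n choose m) * p ^ m * (1 - p) ^ (Suc n - m) * g m)"
    unfolding sum_distrib_right by (intro sum.cong) (auto simp: Suc_diff_le)
  also have "\<dots> = (\<Sum>m\<le>Suc n. real (n choose m) * p ^ m * (1 - p) ^ (Suc n - m) * g m)"
    by simp
  also have "\<dots> = (1 - p) ^ Suc n * g 0
      + (\<Sum>m\<le>n. real (n choose Suc m) * p ^ Suc m * (1 - p) ^ (n - m) * g (Suc m))"
    by (subst sum.atMost_Suc_shift) simp
  finally have *: "(\<Sum>m\<le>n. real (n choose m) * p ^ m * (1 - p) ^ (n - m) * g m) * (1 - p) = \<dots>" .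
  show ?thesis
    apply (subst sum.atMost_Suc_shift)
    apply (subst mult.commute[of "1 - p"])
    apply (subst *)
    apply (simp add: sum_distrib_left sum.distrib [symmetric] algebra_simps del: sum.atMost_Suc)
    done
qed

lemma binomial_weights_sum:
  fixes p :: real
  shows "(\<Sum>m\<le>n. real (n choose m) * p ^ m * (1 - p) ^ (n - m)) = 1"
  using binomial_ring[of p "1 - p" n] by simp

text \<open>Induction on \<open>n\<close>, conditioning on the added trial. A further trial adds
  \<open>1 / Suc n\<close> to the harmonic tail, and its success removes \<open>1 / Suc m\<close>;
  the mean of the removed term comes from size biasing.\<close>

lemma binomial_mean_harm:
  fixes p :: real
  assumes "p \<noteq> 0"
  shows "(\<Sum>m\<le>n. real (n choose m) * p ^ m * (1 - p) ^ (n - m) * (\<Sum>k=Suc m..n. 1 / real k))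
    = (\<Sum>k=1..n. (1 - p) ^ k / real k)"
proof (induction n)
  case (Suc n)
  let ?b = "\<lambda>n m. real (n choose m) * p ^ m * (1 - p) ^ (n - m)"
  let ?h = "\<lambda>m n. \<Sum>k=Suc m..n. 1 / real k"
  have inv: "real (Suc n) * p * (\<Sum>m\<le>n. ?b n m * (1 / real (Suc m))) = 1 - (1 - p) ^ Suc n"
  proof -
    have "real (Suc n) * p * (\<Sum>m\<le>n. ?b n m * (1 / real (Suc m)))
      = (\<Sum>m\<le>Suc n. ?b (Suc n) m * (real m * (1 / real m)))"
      by (rule binomial_mean_Suc [symmetric])
    \<comment> \<open>The factor \<open>m * (1 / m)\<close> is 0 at \<open>m = 0\<close> and 1
      otherwise, so only the weight of the empty sample is lost.\<close>
    also have "\<dots> = (\<Sum>m\<le>n. ?b (Suc n) (Suc m))"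
      by (subst sum.atMost_Suc_shift) (simp del: binomial_Suc_Suc)
    also have "\<dots> = (\<Sum>m\<le>Suc n. ?b (Suc n) m) - (1 - p) ^ Suc n"
      by (subst sum.atMost_Suc_shift) (simp del: binomial_Suc_Suc)
    finally show ?thesis by (simp only: binomial_weights_sum)
  qed
  have h1: "?b n m * ?h m (Suc n) = ?b n m * ?h m n + ?b n m * (1 / real (Suc n))" if "m \<le> n" for m
    using that by (simp add: algebra_simps)
  have h2: "?b n m * ?h (Suc m) (Suc n)
     = ?b n m * ?h m n + ?b n m * (1 / real (Suc n)) - ?b n m * (1 / real (Suc m))" if "m \<le> n" for m
  proof -
    have "?h m (Suc n) = 1 / real (Suc m) + ?h (Suc m) (Suc n)"
      using that by (intro sum.atLeast_Suc_atMost) simp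
    then have "?b n m * ?h (Suc m) (Suc n) = ?b n m * ?h m (Suc n) - ?b n m * (1 / real (Suc m))"
      by (simp only: distrib_left)
    then show ?thesis using h1[OF that] by simp
  qed
  let ?A = "\<Sum>m\<le>n. ?b n m * ?h m n" and ?B = "\<Sum>m\<le>n. ?b n m * (1 / real (Suc m))"
  have c: "(\<Sum>m\<le>n. ?b n m * (1 / real (Suc n))) = 1 / real (Suc n)"
    by (simp only: sum_distrib_right [symmetric] binomial_weights_sum mult_1)
  have s1: "(\<Sum>m\<le>n. ?b n m * ?h m (Suc n)) = ?A + 1 / real (Suc n)"
  proof -
    have "(\<Sum>m\<le>n. ?b n m * ?h m (Suc n)) = (\<Sum>m\<le>n. ?b n m * ?h m n + ?b n m * (1 / real (Suc n)))"
      by (intro sum.cong refl h1) simp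
    then show ?thesis by (simp only: sum.distrib c)
  qed
  have s2: "(\<Sum>m\<le>n. ?b n m * ?h (Suc m) (Suc n)) = ?A + 1 / real (Suc n) - ?B"
  proof -
    have "(\<Sum>m\<le>n. ?b n m * ?h (Suc m) (Suc n))
      = (\<Sum>m\<le>n. ?b n m * ?h m n + ?b n m * (1 / real (Suc n)) - ?b n m * (1 / real (Suc m)))"
      by (intro sum.cong refl h2) simp
    then show ?thesis by (simp only: sum.distrib sum_subtractf c)
  qed
  have "(\<Sum>m\<le>Suc n. ?b (Suc n) m * ?h m (Suc n))
     = (1 - p) * (\<Sum>m\<le>n. ?b n m * ?h m (Suc n)) + p * (\<Sum>m\<le>n. ?b n m * ?h (Suc m) (Suc n))"
    by (rule binomial_sum_Suc)
  also note s1
  also note s2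
  also have "(1 - p) * (?A + 1 / real (Suc n)) + p * (?A + 1 / real (Suc n) - ?B)
      = ?A + 1 / real (Suc n) - p * ?B"
    by (simp only: left_diff_distrib right_diff_distrib mult_1_left)
  also have "p * ?B = (1 - (1 - p) ^ Suc n) / real (Suc n)"
    using inv by (simp add: field_simps)
  also have "?A + 1 / real (Suc n) - (1 - (1 - p) ^ Suc n) / real (Suc n)
      = (\<Sum>k=1..Suc n. (1 - p) ^ k / real k)"
    using Suc by (simp add: diff_divide_distrib)
  finally show ?case .
qed simp

text \<open>The logarithmic series is truncated and its tail bounded by a geometric series. The
  difference of the two sides vanishes at 0 and has the nonnegative derivative
  \<open>y ^ Suc n / (Suc n * (1 - y)\<^sup>2)\<close>.\<close>

lemma neg_ln_le_partial_sum:
  fixes x :: real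
  assumes "0 \<le> x" "x < 1"
  shows "- ln (1 - x) \<le> (\<Sum>k=1..n. x ^ k / real k) + x ^ Suc n / (real (Suc n) * (1 - x))"
proof -
  let ?f = "\<lambda>x::real. (\<Sum>k=1..n. x ^ k / real k) + x ^ Suc n / (real (Suc n) * (1 - x)) + ln (1 - x)"
  have f0: "?f 0 = 0" by (auto intro!: sum.neutral)
  have "?f 0 \<le> ?f x"
  proof (rule DERIV_nonneg_imp_nondecreasing[OF assms(1)])
    fix y :: real assume y: "0 \<le> y" "y \<le> x"
    then have y1: "y < 1" using assms by simp
    have s: "(\<Sum>k=1..n. y ^ (k - 1)) = (1 - y ^ n) / (1 - y)"
      using y1 by (simp add: sum_gp_strict sum.atLeast1_atMost_eq)
    have "((\<lambda>x. \<Sum>k=1..n. x ^ k / real k) has_real_derivative (\<Sum>k=1..n. y ^ (k - 1))) (at y)"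
      by (rule DERIV_sum) (auto intro!: derivative_eq_intros)
    moreover have "((\<lambda>x. x ^ Suc n / (real (Suc n) * (1 - x))) has_real_derivative
        (y ^ n / (1 - y) + y ^ Suc n / (real (Suc n) * (1 - y)\<^sup>2))) (at y)"
    proof -
      have "((\<lambda>x. x ^ Suc n / (real (Suc n) * (1 - x))) has_real_derivative
        ((real (Suc n) * y ^ n * (real (Suc n) * (1 - y)) - y ^ Suc n * (real (Suc n) * - 1))
          / (real (Suc n) * (1 - y) * (real (Suc n) * (1 - y))))) (at y)"
        using y1 DERIV_pow[of "Suc n" y UNIV]
        by (intro DERIV_divide) (auto intro!: derivative_eq_intros)
      moreover have "(real (Suc n) * y ^ n * (real (Suc n) * (1 - y)) - y ^ Suc n * (real (Suc n) * - 1))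
          / (real (Suc n) * (1 - y) * (real (Suc n) * (1 - y)))
         = y ^ n / (1 - y) + y ^ Suc n / (real (Suc n) * (1 - y)\<^sup>2)"
        using y1 by (simp add: divide_simps power2_eq_square del: of_nat_Suc) (simp only: algebra_simps)
      ultimately show ?thesis by simp
    qed
    moreover have "((\<lambda>x. ln (1 - x)) has_real_derivative - 1 / (1 - y)) (at y)"
      using y1 by (auto intro!: derivative_eq_intros)
    ultimately have "(?f has_real_derivative (\<Sum>k=1..n. y ^ (k - 1))
       + (y ^ n / (1 - y) + y ^ Suc n / (real (Suc n) * (1 - y)\<^sup>2)) + - 1 / (1 - y)) (at y)"
      by (intro DERIV_add)
    moreover have "(\<Sum>k=1..n. y ^ (k - 1))
       + (y ^ n / (1 - y) + y ^ Suc n / (real (Suc n) * (1 - y)\<^sup>2)) + - 1 / (1 - y)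
       = y ^ Suc n / (real (Suc n) * (1 - y)\<^sup>2)"
      unfolding s by (simp add: diff_divide_distrib)
    ultimately show "\<exists>d. (?f has_real_derivative d) (at y) \<and> 0 \<le> d"
      using y by (intro exI[of _ "y ^ Suc n / (real (Suc n) * (1 - y)\<^sup>2)"] conjI)
        (simp_all only:, simp)
  qed
  then show ?thesis unfolding f0 by linarith
qed

text \<open>The left-hand side equals \<open>n p (\<Sum>k=1..<n. (1 - p)^k / k) + (1 - p)^n\<close>; its last summand, the event
  of an empty sample, dominates the tail of the logarithmic series.\<close>
lemma binomial_ratio_sum_ge:
  fixes p :: real
  assumes "0 < p" "p < 1" "n \<ge> 1"
  shows "(\<Sum>m\<le>n. real (n choose m) * p ^ m * (1 - p) ^ (n - m)
      * (\<Sum>s=m..<n. if s = 0 then 1 else real m / real s)) \<ge> - real n * p * ln p"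
proof -
  obtain N where n: "n = Suc N" using assms(3) by (cases n) auto
  let ?b = "\<lambda>n m. real (n choose m) * p ^ m * (1 - p) ^ (n - m)"
  let ?q = "\<lambda>m. \<Sum>s=m..<n. if s = 0 then 1 else real m / real s"
  \<comment> \<open>For an empty sample only \<open>s = 0\<close> contributes, by the default value
    1, since \<open>0 / s\<close> vanishes for \<open>s > 0\<close>; for \<open>m > 0\<close> the
    position \<open>s = 0\<close> does not occur.\<close>
  have q: "?q m = of_bool (m = 0) + real m * (\<Sum>k=m..N. 1 / real k)" for m
  proof (cases "m = 0")
    case True
    have "?q 0 = (\<Sum>s\<in>{0::nat}. 1)"
      using n by (intro sum.mono_neutral_cong_right) auto
    then have "?q 0 = 1" by simp
    then show ?thesis unfolding True by simp
  next
    case False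
    then show ?thesis
      unfolding sum_distrib_left using n
      by (auto simp: atLeastLessThanSuc_atLeastAtMost intro!: sum.cong)
  qed
  have "(\<Sum>m\<le>n. ?b n m * ?q m)
      = (\<Sum>m\<le>n. ?b n m * of_bool (m = 0)) + (\<Sum>m\<le>n. ?b n m * (real m * (\<Sum>k=m..N. 1 / real k)))"
    by (simp only: q distrib_left sum.distrib)
  also have "(\<Sum>m\<le>n. ?b n m * of_bool (m = 0)) = (\<Sum>m\<in>{0}. ?b n m)"
    by (intro sum.mono_neutral_cong_right) auto
  also have "\<dots> = (1 - p) ^ n" by simp
  also have "(\<Sum>m\<le>n. ?b n m * (real m * (\<Sum>k=m..N. 1 / real k)))
      = real n * p * (\<Sum>m\<le>N. ?b N m * (\<Sum>k=Suc m..N. 1 / real k))"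
    unfolding n by (rule binomial_mean_Suc)
  also have "\<dots> = real n * p * (\<Sum>k=1..N. (1 - p) ^ k / real k)"
    using assms by (subst binomial_mean_harm) auto
  finally have eq: "(\<Sum>m\<le>n. ?b n m * ?q m) = (1 - p) ^ n + real n * p * (\<Sum>k=1..N. (1 - p) ^ k / real k)" .
  \<comment> \<open>With \<open>x = 1 - p\<close> and \<open>N = n - 1\<close> the error term
    becomes \<open>(1 - p) ^ n / (n * p)\<close>, exactly the empty-sample summand divided by
    \<open>n * p\<close>.\<close>
  have "- ln p \<le> (\<Sum>k=1..N. (1 - p) ^ k / real k) + (1 - p) ^ n / (real n * p)"
    using neg_ln_le_partial_sum[of "1 - p" N] assms n by simp
  then have "real n * p * (- ln p) \<le> real n * p * ((\<Sum>k=1..N. (1 - p) ^ k / real k) + (1 - p) ^ n / (real n * p))"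
    using assms by (intro mult_left_mono) auto
  also have "\<dots> = (\<Sum>m\<le>n. ?b n m * ?q m)"
    using assms unfolding eq by (simp add: distrib_left)
  finally show ?thesis by simp
qed

text \<open>The summand is the tangent at \<open>p\<close> of the square of the sample ratio. The
  loss \<open>p\<^sup>2\<close> is charged to each of the \<open>n - m\<close> arrivals after the
  sample, \<open>n * (1 - p)\<close> on average; one of the two copies of
  \<open>- p\<^sup>2 * ln p\<close> pays for it, since \<open>- ln p \<ge> 1 - p\<close>.\<close>

lemma binomial_quadratic_ge:
  fixes p :: real
  assumes "0 < p" "p < 1" "n \<ge> 1"
  shows "(\<Sum>m\<le>n. real (n choose m) * p ^ m * (1 - p) ^ (n - m)
      * (\<Sum>s=m..<n. 2 * p * (if s = 0 then 1 else real m / real s) - p\<^sup>2)) \<ge> real n * (- p\<^sup>2 * ln p)"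
proof -
  obtain N where n: "n = Suc N" using assms(3) by (cases n) auto
  let ?b = "\<lambda>n m. real (n choose m) * p ^ m * (1 - p) ^ (n - m)"
  let ?q = "\<lambda>m. \<Sum>s=m..<n. if s = 0 then 1 else real m / real s"
  have mean: "(\<Sum>m\<le>n. ?b n m * real m) = real n * p"
    using binomial_mean_Suc[of N p "\<lambda>_. 1"] n binomial_weights_sum[of N p] by simp
  have "(\<Sum>m\<le>n. ?b n m * (\<Sum>s=m..<n. 2 * p * (if s = 0 then 1 else real m / real s) - p\<^sup>2))
    = (\<Sum>m\<le>n. 2 * p * (?b n m * ?q m) - p\<^sup>2 * (real n * ?b n m - ?b n m * real m))"
    by (intro sum.cong refl) (simp add: sum_subtractf sum_distrib_left of_nat_diff algebra_simps)
  also have "\<dots> = 2 * p * (\<Sum>m\<le>n. ?b n m * ?q m) - p\<^sup>2 * (real n * 1 - real n * p)"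
    unfolding sum_subtractf sum_distrib_left [symmetric] mean binomial_weights_sum ..
  also have "\<dots> \<ge> 2 * p * (- real n * p * ln p) - p\<^sup>2 * (real n * 1 - real n * p)"
    using binomial_ratio_sum_ge[OF assms] assms by (intro diff_right_mono mult_left_mono) auto
  also have "2 * p * (- real n * p * ln p) - p\<^sup>2 * (real n * 1 - real n * p)
     = real n * (- p\<^sup>2 * ln p) + real n * p\<^sup>2 * (p - 1 - ln p)"
    by (simp add: algebra_simps power2_eq_square)
  finally have "real n * (- p\<^sup>2 * ln p) + real n * p\<^sup>2 * (p - 1 - ln p) \<le> (\<Sum>m\<le>n. ?b n m *
      (\<Sum>s=m..<n. 2 * p * (if s = 0 then 1 else real m / real s) - p\<^sup>2))" .
  moreover have "0 \<le> real n * p\<^sup>2 * (p - 1 - ln p)"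
    using ln_le_minus_one[OF assms(1)] by (intro mult_nonneg_nonneg) auto
  ultimately show ?thesis by linarith
qed

subsection \<open>Selection along a linear order\<close>

text \<open>The real elements of \<open>T\<close> once \<open>S\<close> has been seen. Dummies are
  left out, so under a strict linear order all of \<open>S\<close> qualifies while \<open>S\<close>
  has at most \<open>r\<close> elements.\<close>

definition top_set :: "nat \<Rightarrow> ('a \<Rightarrow> 'a \<Rightarrow> bool) \<Rightarrow> 'a set \<Rightarrow> 'a set" where
  "top_set r hv S = {x\<in>S. card {y\<in>S. hv y x} < r}"

text \<open>The test of \<open>alg_step\<close> without the independence check, so that it depends
  only on the order of the elements and on their arrival.\<close>

definition selected :: "nat \<Rightarrow> ('a \<Rightarrow> 'a \<Rightarrow> bool) \<Rightarrow> 'a list \<Rightarrow> nat \<Rightarrow> nat \<Rightarrow> bool" where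
  "selected r hv \<pi> m t \<longleftrightarrow>
     (let e = \<pi> ! t; S = set (take t \<pi>) in
        card {x\<in>S. hv x e} < r \<and>
        (card S < r \<or> (\<exists>x\<in>S. card {y\<in>S. hv y x} = r - 1 \<and> x \<in> set (take m \<pi>))))"

text \<open>Totality is asked on \<open>E\<close> only, since \<open>heavier\<close> cannot separate
  two elements that occur in neither of its lists.\<close>

locale strict_linear_order =
  fixes E :: "'a set" and hv :: "'a \<Rightarrow> 'a \<Rightarrow> bool"
  assumes finite_carrier: "finite E"
    and irrefl: "\<not> hv x x"
    and trans: "hv x y \<Longrightarrow> hv y z \<Longrightarrow> hv x z"
    and total: "x \<in> E \<Longrightarrow> y \<in> E \<Longrightarrow> x \<noteq> y \<Longrightarrow> hv x y \<or> hv y x"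
begin

lemma finite_subset_carrier: "S \<subseteq> E \<Longrightarrow> finite S"
  using finite_carrier finite_subset by blast

lemma rank_strict_mono:
  assumes "S \<subseteq> E" "x \<in> S" "hv x y"
  shows "card {z\<in>S. hv z x} < card {z\<in>S. hv z y}"
proof (rule psubset_card_mono)
  show "{z\<in>S. hv z x} \<subset> {z\<in>S. hv z y}"
    using assms(2,3) irrefl trans by blast
qed (use finite_subset_carrier[OF assms(1)] in simp)

lemma rank_inj:
  assumes "S \<subseteq> E" "x \<in> S" "y \<in> S" "card {z\<in>S. hv z x} = card {z\<in>S. hv z y}"
  shows "x = y"
  using assms rank_strict_mono[of S x y] rank_strict_mono[of S y x] total[of x y] by fastforce

lemma rank_less_card:
  assumes "S \<subseteq> E" "x \<in> S"
  shows "card {z\<in>S. hv z x} < card S"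
  using assms finite_subset_carrier irrefl by (intro psubset_card_mono) auto

text \<open>Ranks, the numbers of heavier elements, are injective on \<open>S\<close> and below
  \<open>card S\<close>, so they take every value. This yields the element of rank
  \<open>r - 1\<close>, the one that leaves \<open>T\<close>.\<close>

lemma rank_image:
  assumes "S \<subseteq> E"
  shows "(\<lambda>x. card {z\<in>S. hv z x}) ` S = {..<card S}"
proof (rule card_subset_eq)
  have "inj_on (\<lambda>x. card {z\<in>S. hv z x}) S"
    using rank_inj[OF assms] by (auto intro: inj_onI)
  then show "card ((\<lambda>x. card {z\<in>S. hv z x}) ` S) = card {..<card S}"
    by (simp add: card_image)
qed (use rank_less_card[OF assms] in auto)

lemma card_top_set:
  assumes "S \<subseteq> E"
  shows "card (top_set r hv S) = min r (card S)"
proof -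
  have "inj_on (\<lambda>x. card {z\<in>S. hv z x}) (top_set r hv S)"
    using rank_inj[OF assms] by (auto intro!: inj_onI simp: top_set_def)
  then have "card (top_set r hv S) = card ((\<lambda>x. card {z\<in>S. hv z x}) ` top_set r hv S)"
    by (simp add: card_image)
  also have "(\<lambda>x. card {z\<in>S. hv z x}) ` top_set r hv S = (\<lambda>x. card {z\<in>S. hv z x}) ` S \<inter> {..<r}"
    by (auto simp: top_set_def)
  also have "\<dots> = {..<min r (card S)}"
    unfolding rank_image[OF assms] by auto
  finally show ?thesis by simp
qed

text \<open>A selected element replaces a sample element or a dummy in the top set, and a rejected one
  never decreases the number of top elements from outside the sample.\<close>
lemma card_selected_le:
  assumes "distinct \<pi>" "set \<pi> = E" "m \<le> t" "t \<le> length \<pi>" "r \<ge> 1"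
  shows "card {s\<in>{m..<t}. selected r hv \<pi> m s}
    \<le> card (top_set r hv (set (take t \<pi>)) - set (take m \<pi>))"
  using assms(3,4)
proof (induction t rule: dec_induct)
  case (step t)
  define S where "S = set (take t \<pi>)"
  define e where "e = \<pi> ! t"
  let ?J = "set (take m \<pi>)"
  define N where "N = top_set r hv S - ?J"
  define N' where "N' = top_set r hv (insert e S) - ?J"
  have t: "t < length \<pi>" using step.prems by simp
  have S': "set (take (Suc t) \<pi>) = insert e S"
    using t by (simp add: take_Suc_conv_app_nth S_def e_def)
  have "distinct (take (Suc t) \<pi>)" using assms(1) by simp
  then have eS: "e \<notin> S"
    using t by (simp add: take_Suc_conv_app_nth S_def e_def)
  have SE: "S \<subseteq> E" and eE: "e \<in> E"
    using assms(2) t set_take_subset[of t \<pi>] by (auto simp: S_def e_def)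
  have JS: "?J \<subseteq> S" using step.hyps by (simp add: S_def set_take_subset_set_take)
  have finS: "finite S" by (simp add: S_def)
  have fin: "finite N'" by (simp add: N'_def top_set_def finS)
  have finN: "finite N" by (simp add: N_def top_set_def finS)
  have cnt: "card {y\<in>insert e S. hv y x} = card {y\<in>S. hv y x} + of_bool (hv e x)" for x
  proof -
    have "{y\<in>insert e S. hv y x} = (if hv e x then insert e {y\<in>S. hv y x} else {y\<in>S. hv y x})"
      by auto
    then show ?thesis using eS finS by simp
  qed
  have N'_iff: "x \<in> N' \<longleftrightarrow>
      (x = e \<or> x \<in> S) \<and> card {y\<in>S. hv y x} + of_bool (hv e x) < r \<and> x \<notin> ?J" for x
    unfolding N'_def top_set_def cnt by auto
  have IH: "card {s\<in>{m..<t}. selected r hv \<pi> m s} \<le> card N"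
    using step.IH t by (simp add: N_def S_def)
  \<comment> \<open>The new arrival raises ranks by at most one, so only the element of rank exactly
    \<open>r - 1\<close> can drop out, and only if \<open>e\<close> beats it.\<close>
  have lost: "card {y\<in>S. hv y x} = r - 1 \<and> hv e x \<and> x \<in> S \<and> x \<notin> ?J" if "x \<in> N - N'" for x
    using that assms(5) by (cases "hv e x") (auto simp: N_def N'_iff top_set_def)
  show ?case
  proof (cases "selected r hv \<pi> m t")
    case True
    \<comment> \<open>Selection requires the element of rank \<open>r - 1\<close> to be absent or in
      the sample; by uniqueness of ranks nothing outside the sample is displaced.\<close>
    have "N \<subseteq> N'"
    proof
      fix x assume x: "x \<in> N"
      show "x \<in> N'"
      proof (rule ccontr)
        assume "x \<notin> N'"
        then have l: "card {y\<in>S. hv y x} = r - 1" "x \<in> S" "x \<notin> ?J" using lost[of x] x by auto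
        then have "\<not> card S < r" using rank_less_card[OF SE, of x] by simp
        then obtain z where "z \<in> S" "card {y\<in>S. hv y z} = r - 1" "z \<in> ?J"
          using True by (auto simp: selected_def Let_def S_def)
        then show False using rank_inj[OF SE, of x z] l by auto
      qed
    qed
    moreover have "e \<in> N'"
      using True eS JS by (auto simp: N'_iff irrefl selected_def Let_def S_def e_def)
    moreover have "e \<notin> N" using eS by (simp add: N_def top_set_def)
    ultimately have "Suc (card N) \<le> card N'"
      using card_mono[OF fin, of "insert e N"] finN by simp
    moreover have "{s\<in>{m..<Suc t}. selected r hv \<pi> m s} = insert t {s\<in>{m..<t}. selected r hv \<pi> m s}"
      using True step.hyps by auto
    ultimately show ?thesis using IH by (simp add: S' N'_def)
  next
    case False
    have "card N \<le> card N'"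
    proof (cases "N \<subseteq> N'")
      case True
      then show ?thesis using fin by (rule card_mono[rotated])
    next
      case False
      then obtain x where x: "x \<in> N - N'" by blast
      \<comment> \<open>By uniqueness of ranks \<open>x\<close> is the only loss, and
        \<open>e\<close>, which beats \<open>x\<close> and is no sample element, takes its
        place.\<close>
      have "N - {x} \<subseteq> N'"
      proof
        fix y assume y: "y \<in> N - {x}"
        show "y \<in> N'"
        proof (rule ccontr)
          assume "y \<notin> N'"
          then show False using lost[of y] lost[OF x] rank_inj[OF SE, of y x] y by auto
        qed
      qed
      moreover have "e \<in> N'"
      proof -
        have "card {y\<in>S. hv y e} \<le> card {y\<in>S. hv y x}"
          using lost[OF x] trans finS by (intro card_mono) auto
        then show ?thesis
          using lost[OF x] assms(5) eS JS by (auto simp: N'_iff irrefl)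
      qed
      moreover have "e \<notin> N" using eS by (simp add: N_def top_set_def)
      ultimately have "card (insert e (N - {x})) \<le> card N'"
        using fin by (intro card_mono) auto
      then show ?thesis using x finN \<open>e \<notin> N\<close>
        by (simp add: card_Suc_Diff1)
    qed
    moreover have "{s\<in>{m..<Suc t}. selected r hv \<pi> m s} = {s\<in>{m..<t}. selected r hv \<pi> m s}"
      using False by (auto simp: less_Suc_eq)
    ultimately show ?thesis using IH by (simp add: S' N'_def)
  qed
qed simp

end

section \<open>Exchangeability of the arrival order\<close>

text \<open>Renaming by the transposition is an involution of \<open>Q\<close> that trades
  membership of \<open>x\<close> in the sample for membership of \<open>y\<close>, while it permutes
  \<open>T\<close> and thus keeps the number of its sample elements.\<close>

lemma sum_swap_invariant:
  fixes g :: "nat \<Rightarrow> real"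
  assumes closed: "\<And>\<pi> x y. \<pi> \<in> Q \<Longrightarrow> x \<in> T \<Longrightarrow> y \<in> T \<Longrightarrow> map (Transposition.transpose x y) \<pi> \<in> Q"
    and "x \<in> T" "y \<in> T"
  shows "(\<Sum>\<pi>\<in>Q. of_bool (x \<in> set (take m \<pi>)) * g (card (T \<inter> set (take m \<pi>))))
    = (\<Sum>\<pi>\<in>Q. of_bool (y \<in> set (take m \<pi>)) * g (card (T \<inter> set (take m \<pi>))))"
proof -
  let ?t = "Transposition.transpose x y"
  show ?thesis
  proof (rule sum.reindex_bij_witness[where i = "map ?t" and j = "map ?t"])
    fix \<pi> assume \<pi>: "\<pi> \<in> Q"
    show "map ?t (map ?t \<pi>) = \<pi>" "map ?t (map ?t \<pi>) = \<pi>"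
      by (simp_all only: map_map transpose_comp_involutory list.map_id)
    show "map ?t \<pi> \<in> Q" "map ?t \<pi> \<in> Q" using closed \<pi> assms by auto
    have J: "set (take m (map ?t \<pi>)) = ?t ` set (take m \<pi>)" by (simp add: take_map)
    have inj: "inj_on ?t A" for A by (rule inj_on_transpose)
    have "y \<in> ?t ` A \<longleftrightarrow> x \<in> A" for A
    proof -
      have "y = ?t x" by simp
      then show ?thesis by (metis inj image_eqI inj_image_mem_iff)
    qed
    moreover have "T \<inter> ?t ` A = ?t ` (T \<inter> A)" for A
    proof -
      have "?t ` T = T"
        using assms(2,3) by (auto simp: Transposition.transpose_def image_iff split: if_splits)
      then show ?thesis using image_Int[OF inj_transpose, of x y T A] by simp
    qed
    ultimately show "of_bool (y \<in> set (take m (map ?t \<pi>))) * g (card (T \<inter> set (take m (map ?t \<pi>))))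
      = of_bool (x \<in> set (take m \<pi>)) * g (card (T \<inter> set (take m \<pi>)))"
      unfolding J by (simp add: card_image[OF inj])
  qed
qed

text \<open>Expands the cardinality into indicators, which contribute equally by symmetry. A
  constant \<open>g\<close> gives first moments, a linear \<open>g\<close> second moments.\<close>

lemma sum_card_swap_invariant:
  fixes g :: "nat \<Rightarrow> real"
  assumes "finite T"
    and closed: "\<And>\<pi> x y. \<pi> \<in> Q \<Longrightarrow> x \<in> T \<Longrightarrow> y \<in> T \<Longrightarrow> map (Transposition.transpose x y) \<pi> \<in> Q"
    and "x \<in> T"
  shows "(\<Sum>\<pi>\<in>Q. real (card (T \<inter> set (take m \<pi>))) * g (card (T \<inter> set (take m \<pi>))))
    = real (card T) * (\<Sum>\<pi>\<in>Q. of_bool (x \<in> set (take m \<pi>)) * g (card (T \<inter> set (take m \<pi>))))"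
proof -
  have "(\<Sum>\<pi>\<in>Q. real (card (T \<inter> set (take m \<pi>))) * g (card (T \<inter> set (take m \<pi>))))
     = (\<Sum>\<pi>\<in>Q. \<Sum>y\<in>T. of_bool (y \<in> set (take m \<pi>)) * g (card (T \<inter> set (take m \<pi>))))"
    using assms(1) by (simp add: sum_distrib_right [symmetric] sum_of_bool_eq Int_def)
  also have "\<dots> = (\<Sum>y\<in>T. \<Sum>\<pi>\<in>Q. of_bool (y \<in> set (take m \<pi>)) * g (card (T \<inter> set (take m \<pi>))))"
    by (rule sum.swap)
  also have "\<dots> = (\<Sum>y\<in>T. \<Sum>\<pi>\<in>Q. of_bool (x \<in> set (take m \<pi>)) * g (card (T \<inter> set (take m \<pi>))))"
    using assms by (intro sum.cong refl sum_swap_invariant) auto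
  finally show ?thesis by simp
qed

lemma map_transpose_in_permutations:
  assumes "\<pi> \<in> permutations_of_set E" "x \<in> E" "y \<in> E"
  shows "map (Transposition.transpose x y) \<pi> \<in> permutations_of_set E"
proof -
  have "bij_betw (Transposition.transpose x y) E E"
    using assms by (intro permutes_imp_bij permutes_swap_id)
  then show ?thesis
    using assms(1) by (auto simp: permutations_of_set_def distinct_map bij_betw_def)
qed

text \<open>Transpositions match the classes of any two values at position \<open>s\<close>, and
  these classes partition all permutations.\<close>

lemma card_permutations_nth_eq:
  assumes "finite E" "e \<in> E" "s < card E"
  shows "card {\<pi>\<in>permutations_of_set E. \<pi> ! s = e} = fact (card E - 1)"
proof -
  let ?Q = "\<lambda>x. {\<pi>\<in>permutations_of_set E. \<pi> ! s = x}"
  have len: "length \<pi> = card E" if "\<pi> \<in> permutations_of_set E" for \<pi>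
    using that by (simp add: length_finite_permutations_of_set)
  have eq: "card (?Q x) = card (?Q e)" if x: "x \<in> E" for x
  proof (rule bij_betw_same_card)
    let ?t = "Transposition.transpose x e"
    show "bij_betw (map ?t) (?Q x) (?Q e)"
    proof (rule bij_betw_byWitness[where f' = "map ?t"])
      show "map ?t ` ?Q x \<subseteq> ?Q e" "map ?t ` ?Q e \<subseteq> ?Q x"
        using map_transpose_in_permutations[OF _ x assms(2)] assms(3) len by auto
    qed (simp_all add: transpose_comp_involutory)
  qed
  have "(fact (card E) :: nat) = card (permutations_of_set E)"
    using assms(1) by simp
  also have "\<dots> = card (\<Union>x\<in>E. ?Q x)"
    using assms(3) len nth_mem by (intro arg_cong[where f = card])
      (fastforce simp: permutations_of_set_def)
  also have "\<dots> = (\<Sum>x\<in>E. card (?Q x))"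
    using assms(1) by (intro card_UN_disjoint) auto
  also have "\<dots> = (\<Sum>x\<in>E. card (?Q e))"
    using eq by (intro sum.cong) auto
  also have "\<dots> = card E * card (?Q e)"
    by simp
  finally have "card E * fact (card E - 1) = card E * card (?Q e)"
    using assms(3) by (simp add: fact_reduce)
  then show ?thesis using assms(3) by simp
qed

section \<open>Selection of a fixed element at a fixed time\<close>

context strict_linear_order
begin

text \<open>Conditions on the set \<open>S\<close> of the first \<open>s\<close> arrivals and on the
  next arrival \<open>e\<close>. This fixes \<open>T\<close> and the element about to leave it,
  while the sample still varies with the order inside \<open>S\<close>.\<close>

lemma selected_class_sum_ge:
  fixes p :: real
  assumes r: "r \<ge> 1" and p: "0 \<le> p" "p \<le> 1" and m: "m \<le> s" and S: "S \<subseteq> E" "card S = s"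
    and e: "e \<in> top_set r hv E - S"
    and Q: "Q = {\<pi>\<in>permutations_of_set E. set (take s \<pi>) = S \<and> \<pi> ! s = e}"
  shows "(\<Sum>\<pi>\<in>Q. of_bool (selected r hv \<pi> m s)
        * (1 - real (card (top_set r hv (set (take s \<pi>)) - set (take m \<pi>))) / real r))
      \<ge> (2 * p * (if s = 0 then 1 else real m / real s) - p\<^sup>2) * real (card Q)"
proof -
  let ?J = "\<lambda>\<pi>. set (take m \<pi>)"
  have eE: "e \<in> E" "e \<notin> S" using e by (auto simp: top_set_def)
  have finS: "finite S" using S(1) by (rule finite_subset_carrier)
  have "card (insert e S) \<le> card E" using S eE finite_carrier by (intro card_mono) auto
  then have sn: "s < card E" using S(2) eE finS by simp
  have len: "length \<pi> = card E" and dist: "distinct \<pi>" if "\<pi> \<in> Q" for \<pi>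
    using that by (auto simp: Q permutations_of_set_def distinct_card)
  have J: "?J \<pi> \<subseteq> S" "card (?J \<pi>) = m" if "\<pi> \<in> Q" for \<pi>
  proof -
    show "?J \<pi> \<subseteq> S" using that m by (auto simp: Q set_take_subset_set_take dest: set_take_subset_set_take[THEN subsetD, rotated])
    show "card (?J \<pi>) = m" using len[OF that] dist[OF that] m sn by (simp add: distinct_card)
  qed
  \<comment> \<open>A square lies above its tangent at \<open>p\<close>; this reduces the second
    moment of the sample share of \<open>T\<close> to its mean.\<close>
  have sq: "2 * p * q - p\<^sup>2 \<le> q\<^sup>2" for q :: real
    using zero_le_power2[of "q - p"] by (simp add: power2_diff algebra_simps)
  have enters: "card {x\<in>S. hv x e} < r"
  proof -
    have "card {x\<in>S. hv x e} \<le> card {x\<in>E. hv x e}"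
      using S finite_carrier by (intro card_mono) auto
    then show ?thesis using e by (simp add: top_set_def)
  qed
  show ?thesis
  proof (cases "s < r")
    \<comment> \<open>While \<open>s < r\<close> a dummy leaves, so \<open>e\<close> is certainly
      selected and \<open>T\<close> holds \<open>s - m\<close> elements from outside the sample.
      Then \<open>1 - (s - m) / r\<close> is at least the ratio \<open>?q \<le> 1\<close>, hence at
      least its square.\<close>
    case True
    let ?q = "if s = 0 then 1 else real m / real s"
    have top: "top_set r hv S = S"
      using rank_less_card[OF S(1)] S(2) True by (fastforce simp: top_set_def)
    have bnd: "2 * p * ?q - p\<^sup>2 \<le> 1 - real (s - m) / real r"
    proof -
      have "2 * p * ?q - p\<^sup>2 \<le> ?q\<^sup>2"
        by (rule sq)
      also have "\<dots> \<le> ?q"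
        using m power_decreasing[of 1 2 ?q] by auto
      also have "\<dots> \<le> 1 - real (s - m) / real r"
      proof (cases "s = 0")
        case False
        have "real (s - m) / real r \<le> real (s - m) / real s"
          using True False by (intro divide_left_mono) auto
        also have "\<dots> = 1 - real m / real s"
          using m False by (simp add: of_nat_diff diff_divide_distrib)
        finally show ?thesis using False by simp
      qed simp
      finally show ?thesis .
    qed
    have "(\<Sum>\<pi>\<in>Q. 2 * p * ?q - p\<^sup>2) \<le> (\<Sum>\<pi>\<in>Q. of_bool (selected r hv \<pi> m s)
        * (1 - real (card (top_set r hv (set (take s \<pi>)) - ?J \<pi>)) / real r))"
    proof (rule sum_mono)
      fix \<pi> assume \<pi>: "\<pi> \<in> Q"
      have "selected r hv \<pi> m s"
        using \<pi> enters True S(2) by (simp add: selected_def Q)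
      moreover have "card (top_set r hv (set (take s \<pi>)) - ?J \<pi>) = s - m"
        using \<pi> J[OF \<pi>] S(2) finS by (simp add: Q top card_Diff_subset)
      ultimately show "2 * p * ?q - p\<^sup>2 \<le> of_bool (selected r hv \<pi> m s)
        * (1 - real (card (top_set r hv (set (take s \<pi>)) - ?J \<pi>)) / real r)"
        using bnd by simp
    qed
    then show ?thesis by (simp add: mult.commute)
  next
    case False
    let ?T = "top_set r hv S"
    have TS: "?T \<subseteq> S" by (auto simp: top_set_def)
    have finT: "finite ?T" using TS finS by (rule finite_subset)
    have cT: "card ?T = r" using card_top_set[OF S(1)] S(2) False by simp
    have "r - 1 \<in> (\<lambda>x. card {z\<in>S. hv z x}) ` S"
      unfolding rank_image[OF S(1)] using S(2) False r by simp
    then obtain l where l: "l \<in> S" "card {z\<in>S. hv z l} = r - 1" by auto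
    have lT: "l \<in> ?T" using l r by (simp add: top_set_def)
    \<comment> \<open>A transposition inside \<open>S\<close> preserves the set of the first
      \<open>s\<close> arrivals and fixes \<open>e\<close>.\<close>
    have closed: "map (Transposition.transpose x y) \<pi> \<in> Q" if "\<pi> \<in> Q" "x \<in> S" "y \<in> S" for \<pi> x y
    proof -
      have "Transposition.transpose x y ` S = S"
        using that by (auto simp: Transposition.transpose_def image_iff split: if_splits)
      moreover have "Transposition.transpose x y e = e"
        using eE that by (auto simp: Transposition.transpose_def)
      moreover have "map (Transposition.transpose x y) \<pi> \<in> permutations_of_set E"
        using that S by (intro map_transpose_in_permutations) (auto simp: Q)
      ultimately show ?thesis using that len[OF that(1)] sn by (simp add: Q take_map)
    qed
    let ?Y = "\<lambda>\<pi>. real (card (?T \<inter> ?J \<pi>))"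
    \<comment> \<open>Exchangeability over all of \<open>S\<close>, which contains exactly
      \<open>m\<close> sample elements, gives each element of \<open>S\<close> the sample frequency
      \<open>m / s\<close>.\<close>
    have inJ: "real s * (\<Sum>\<pi>\<in>Q. of_bool (x \<in> ?J \<pi>)) = real m * real (card Q)" if "x \<in> S" for x
    proof -
      have "real s * (\<Sum>\<pi>\<in>Q. of_bool (x \<in> ?J \<pi>)) = (\<Sum>\<pi>\<in>Q. real (card (S \<inter> ?J \<pi>)))"
        using sum_card_swap_invariant[OF finS closed that, where g = "\<lambda>_. 1" and m = m] S(2) by simp
      also have "\<dots> = (\<Sum>\<pi>\<in>Q. real m)"
        using J by (intro sum.cong) (auto simp: Int_absorb1)
      finally show ?thesis by (simp add: mult.commute)
    qed
    have closedT: "map (Transposition.transpose x y) \<pi> \<in> Q" if "\<pi> \<in> Q" "x \<in> ?T" "y \<in> ?T" for \<pi> x y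
      using that closed TS by blast
    have mean: "(\<Sum>\<pi>\<in>Q. ?Y \<pi> / real r) = real m / real s * real (card Q)"
    proof -
      have "(\<Sum>\<pi>\<in>Q. ?Y \<pi>) = real r * (\<Sum>\<pi>\<in>Q. of_bool (l \<in> ?J \<pi>))"
        using sum_card_swap_invariant[OF finT closedT lT, where g = "\<lambda>_. 1" and m = m] cT by simp
      moreover have "(\<Sum>\<pi>\<in>Q. of_bool (l \<in> ?J \<pi>)) = real m / real s * real (card Q)"
        using inJ[OF l(1)] False r by (simp add: field_simps)
      ultimately show ?thesis using r by (simp add: sum_divide_distrib [symmetric])
    qed
    \<comment> \<open>\<open>l\<close> is the element leaving the top set; by symmetry it may be averaged over the whole top set.\<close>
    have square: "(\<Sum>\<pi>\<in>Q. of_bool (l \<in> ?J \<pi>) * (?Y \<pi> / real r)) = (\<Sum>\<pi>\<in>Q. (?Y \<pi> / real r)\<^sup>2)"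
    proof -
      have "(\<Sum>\<pi>\<in>Q. ?Y \<pi> * (?Y \<pi> / real r))
         = real r * (\<Sum>\<pi>\<in>Q. of_bool (l \<in> ?J \<pi>) * (?Y \<pi> / real r))"
        using sum_card_swap_invariant[OF finT closedT lT, where g = "\<lambda>k. real k / real r" and m = m] cT
        by simp
      then have "(\<Sum>\<pi>\<in>Q. of_bool (l \<in> ?J \<pi>) * (?Y \<pi> / real r)) = (\<Sum>\<pi>\<in>Q. ?Y \<pi> * (?Y \<pi> / real r)) / real r"
        using r by simp
      also have "\<dots> = (\<Sum>\<pi>\<in>Q. (?Y \<pi> / real r)\<^sup>2)"
        by (simp add: sum_divide_distrib power2_eq_square)
      finally show ?thesis .
    qed
    have "(2 * p * (real m / real s) - p\<^sup>2) * real (card Q)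
       = 2 * p * (\<Sum>\<pi>\<in>Q. ?Y \<pi> / real r) - (\<Sum>\<pi>\<in>Q. p\<^sup>2)"
      unfolding mean by (simp add: algebra_simps)
    also have "\<dots> = (\<Sum>\<pi>\<in>Q. 2 * p * (?Y \<pi> / real r) - p\<^sup>2)"
      by (simp only: sum_subtractf sum_distrib_left)
    also have "\<dots> \<le> (\<Sum>\<pi>\<in>Q. (?Y \<pi> / real r)\<^sup>2)"
    proof (rule sum_mono)
      fix \<pi> show "2 * p * (?Y \<pi> / real r) - p\<^sup>2 \<le> (?Y \<pi> / real r)\<^sup>2"
        by (rule sq)
    qed
    also have "\<dots> = (\<Sum>\<pi>\<in>Q. of_bool (l \<in> ?J \<pi>) * (?Y \<pi> / real r))"
      by (rule square [symmetric])
    also have "\<dots> \<le> (\<Sum>\<pi>\<in>Q. of_bool (selected r hv \<pi> m s)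
        * (1 - real (card (top_set r hv (set (take s \<pi>)) - ?J \<pi>)) / real r))"
    proof (rule sum_mono)
      fix \<pi> assume \<pi>: "\<pi> \<in> Q"
      have SQ: "set (take s \<pi>) = S" "\<pi> ! s = e" using \<pi> by (auto simp: Q)
      have "card (?T - ?J \<pi>) = r - card (?T \<inter> ?J \<pi>)"
        using finT cT by (simp add: card_Diff_subset_Int)
      moreover have "card (?T \<inter> ?J \<pi>) \<le> r"
        using card_mono[OF finT, of "?T \<inter> ?J \<pi>"] cT by simp
      ultimately have Y: "1 - real (card (?T - ?J \<pi>)) / real r = ?Y \<pi> / real r"
        using r by (simp add: of_nat_diff diff_divide_distrib)
      \<comment> \<open>As one of the \<open>r\<close> heaviest elements of \<open>E\<close>,
        \<open>e\<close> enters \<open>T\<close>; it is selected as soon as \<open>l\<close>, the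
        element it displaces, is in the sample.\<close>
      have "l \<in> ?J \<pi> \<Longrightarrow> selected r hv \<pi> m s"
        using l enters SQ by (auto simp: selected_def)
      then show "of_bool (l \<in> ?J \<pi>) * (?Y \<pi> / real r) \<le> of_bool (selected r hv \<pi> m s)
        * (1 - real (card (top_set r hv (set (take s \<pi>)) - ?J \<pi>)) / real r)"
        unfolding SQ Y by auto
    qed
    finally show ?thesis using False r by simp
  qed
qed

text \<open>The permutations with \<open>e\<close> at position \<open>s\<close> are split by the set
  of the first \<open>s\<close> arrivals; each nonempty class satisfies the same bound relative to
  its size.\<close>

lemma selected_sum_ge:
  fixes p :: real
  assumes r: "r \<ge> 1" and p: "0 \<le> p" "p \<le> 1" and m: "m \<le> s" and s: "s < card E"
    and e: "e \<in> top_set r hv E"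
  shows "(\<Sum>\<pi> | \<pi> \<in> permutations_of_set E \<and> \<pi> ! s = e. of_bool (selected r hv \<pi> m s)
        * (1 - real (card (top_set r hv (set (take s \<pi>)) - set (take m \<pi>))) / real r))
      \<ge> (2 * p * (if s = 0 then 1 else real m / real s) - p\<^sup>2) * fact (card E - 1)"
proof -
  let ?A = "{\<pi>. \<pi> \<in> permutations_of_set E \<and> \<pi> ! s = e}"
  let ?Q = "\<lambda>S. {\<pi>\<in>?A. set (take s \<pi>) = S}"
  let ?c = "2 * p * (if s = 0 then 1 else real m / real s) - p\<^sup>2"
  let ?f = "\<lambda>\<pi>. of_bool (selected r hv \<pi> m s)
        * (1 - real (card (top_set r hv (set (take s \<pi>)) - set (take m \<pi>))) / real r)"
  have finA: "finite ?A" by simp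
  have sub: "(\<lambda>\<pi>. set (take s \<pi>)) ` ?A \<subseteq> Pow E"
    by (auto simp: permutations_of_set_def dest: in_set_takeD)
  have finP: "finite (Pow E)" using finite_carrier by simp
  have eE: "e \<in> E" using e by (simp add: top_set_def)
  have "card ?A = fact (card E - 1)"
    using card_permutations_nth_eq[OF finite_carrier eE s] by simp
  then have "?c * fact (card E - 1) = (\<Sum>\<pi>\<in>?A. ?c)"
    by (simp add: mult.commute)
  also have "\<dots> = (\<Sum>S\<in>Pow E. \<Sum>\<pi>\<in>?Q S. ?c)"
    by (rule sum.group[OF finA finP sub, symmetric])
  also have "\<dots> \<le> (\<Sum>S\<in>Pow E. \<Sum>\<pi>\<in>?Q S. ?f \<pi>)"
  proof (rule sum_mono)
    fix S assume S: "S \<in> Pow E"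
    show "(\<Sum>\<pi>\<in>?Q S. ?c) \<le> (\<Sum>\<pi>\<in>?Q S. ?f \<pi>)"
    proof (cases "?Q S = {}")
      case True
      then show ?thesis by (simp only: sum.empty)
    next
      case False
      then obtain \<pi> where \<pi>: "\<pi> \<in> permutations_of_set E" "\<pi> ! s = e" "set (take s \<pi>) = S" by blast
      have d: "distinct \<pi>" "length \<pi> = card E"
        using \<pi> by (auto simp: permutations_of_set_def distinct_card)
      have "distinct (take (Suc s) \<pi>)" using d by simp
      then have "e \<notin> S" using \<pi> d s by (auto simp: take_Suc_conv_app_nth)
      moreover have "card S = s" using \<pi>(3) d s distinct_card[of "take s \<pi>"] by simp
      moreover have "?Q S = {\<pi>\<in>permutations_of_set E. set (take s \<pi>) = S \<and> \<pi> ! s = e}" by blast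
      ultimately have "?c * real (card (?Q S)) \<le> (\<Sum>\<pi>\<in>?Q S. ?f \<pi>)"
        using selected_class_sum_ge[OF r p m, of S e "?Q S"] S e by blast
      then show ?thesis by (simp add: mult.commute)
    qed
  qed
  also have "\<dots> = (\<Sum>\<pi>\<in>?A. ?f \<pi>)"
    by (rule sum.group[OF finA finP sub])
  finally show ?thesis .
qed

end

subsection \<open>Random relabelling\<close>

lemma pos_nth:
  assumes "distinct xs" "i < length xs"
  shows "pos xs (xs ! i) = i"
  unfolding pos_def using assms by (intro Least_equality) (auto simp: nth_eq_iff_index_eq)

lemma pos_less_nth:
  assumes "x \<in> set xs"
  shows "pos xs x < length xs" "xs ! pos xs x = x"
proof -
  have "\<exists>i. i < length xs \<and> xs ! i = x" using assms by (simp add: in_set_conv_nth)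
  then have "pos xs x < length xs \<and> xs ! pos xs x = x"
    unfolding pos_def by (rule LeastI_ex)
  then show "pos xs x < length xs" "xs ! pos xs x = x" by auto
qed

lemma pos_map:
  assumes "inj f"
  shows "pos (map f xs) (f x) = pos xs x"
proof -
  have "i < length (map f xs) \<and> map f xs ! i = f x \<longleftrightarrow> i < length xs \<and> xs ! i = x" for i
    using assms by (auto simp: inj_eq)
  then show ?thesis unfolding pos_def by simp
qed

lemma wt_map: "inj f \<Longrightarrow> wt w (map f \<sigma>) (f x) = wt w \<sigma> x"
  by (simp add: wt_def pos_map)

lemma heavier_map: "inj f \<Longrightarrow> heavier w (map f \<sigma>) (map f \<tau>) (f x) (f y) = heavier w \<sigma> \<tau> x y"
  by (simp add: heavier_def wt_map pos_map)

text \<open>Selection only uses comparisons and arrival positions, so an injective renaming that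
  transports the order preserves it.\<close>

lemma selected_map:
  assumes f: "inj f" and hv: "\<And>x y. hv' (f x) (f y) = hv x y" and t: "t < length \<pi>"
  shows "selected r hv' (map f \<pi>) m t = selected r hv \<pi> m t"
proof -
  have inj: "inj_on f A" for A using inj_on_subset[OF f] by simp
  have "{x \<in> f ` S. hv' x (f e)} = f ` {x\<in>S. hv x e}" for S e
    by (auto simp: hv)
  then have cnt: "card {x \<in> f ` S. hv' x (f e)} = card {x\<in>S. hv x e}" for S e
    by (simp add: card_image[OF inj])
  have mem: "f x \<in> f ` A \<longleftrightarrow> x \<in> A" for x A
    using f by (auto dest: injD)
  have bex: "(\<exists>x\<in>f ` A. Q x) \<longleftrightarrow> (\<exists>x\<in>A. Q (f x))" for A Q
    by blast
  show ?thesis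
    unfolding selected_def Let_def take_map set_map nth_map[OF t] bex cnt card_image[OF inj] mem ..
qed

lemma strict_linear_order_heavier:
  assumes "finite E" "set \<tau> = E"
  shows "strict_linear_order E (heavier w \<sigma> \<tau>)"
proof
  fix x y assume xy: "x \<in> E" "y \<in> E" "x \<noteq> y"
  have "pos \<tau> x \<noteq> pos \<tau> y" using pos_less_nth(2)[of _ \<tau>] xy assms(2) by metis
  then show "heavier w \<sigma> \<tau> x y \<or> heavier w \<sigma> \<tau> y x" by (auto simp: heavier_def)
qed (use assms in \<open>auto simp: heavier_def\<close>)

section \<open>Total weight of the heaviest elements\<close>

lemma sum_eq_if_const_on_diff:
  fixes f :: "'a \<Rightarrow> real"
  assumes "finite A" "finite B" "card A = card B"
    and eq: "\<And>a b. a \<in> A - B \<Longrightarrow> b \<in> B - A \<Longrightarrow> f a = f b"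
  shows "sum f A = sum f B"
proof -
  have cd: "card (A - B) = card (B - A)"
    using assms(1-3) by (simp add: card_Diff_subset_Int Int_commute)
  obtain h where h: "bij_betw h (A - B) (B - A)"
    using finite_same_card_bij[OF _ _ cd] assms(1,2) by auto
  have "sum f (A - B) = (\<Sum>a\<in>A - B. f (h a))"
    using eq bij_betwE[OF h] by (intro sum.cong) auto
  also have "\<dots> = sum f (B - A)"
    by (rule sum.reindex_bij_betw[OF h])
  finally have "sum f (A - B) = sum f (B - A)" .
  moreover have "sum f A = sum f (A - B) + sum f (A \<inter> B)" "sum f B = sum f (B - A) + sum f (A \<inter> B)"
    using assms(1,2) sum.Int_Diff[of A f B] sum.Int_Diff[of B f A] by (simp_all add: Int_commute)
  ultimately show ?thesis by simp
qed

lemma sum_wt_initial: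
  assumes \<sigma>: "distinct \<sigma>" and r: "r \<le> length \<sigma>"
  shows "(\<Sum>e\<in>set (take r \<sigma>). wt w \<sigma> e) = (\<Sum>i=1..r. w i)"
proof -
  have "(\<Sum>e\<in>set (take r \<sigma>). wt w \<sigma> e) = (\<Sum>i<r. w (i + 1))"
  proof (rule sum.reindex_bij_witness[where i = "(!) \<sigma>" and j = "pos \<sigma>"])
    fix e assume "e \<in> set (take r \<sigma>)"
    then obtain i where i: "i < r" "e = \<sigma> ! i" using r by (auto simp: in_set_conv_nth)
    then have "pos \<sigma> e = i" using pos_nth[OF \<sigma>] r by simp
    then show "\<sigma> ! pos \<sigma> e = e" "pos \<sigma> e \<in> {..<r}" "w (pos \<sigma> e + 1) = wt w \<sigma> e"
      using i by (auto simp: wt_def)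
  next
    fix i assume "i \<in> {..<r}"
    then show "pos \<sigma> (\<sigma> ! i) = i" "\<sigma> ! i \<in> set (take r \<sigma>)"
      using pos_nth[OF \<sigma>] r by (auto simp: in_set_conv_nth intro!: exI[of _ i])
  qed
  also have "\<dots> = (\<Sum>i=1..r. w i)"
    by (rule sum.reindex_bij_witness[where i = "\<lambda>i. i - 1" and j = Suc]) auto
  finally show ?thesis .
qed

text \<open>Ties are broken by \<open>\<tau>\<close>, so the top set may differ from the first
  \<open>r\<close> elements of \<open>\<sigma>\<close>. Elements \<open>a\<close> and
  \<open>b\<close> of the two differences satisfy both weight inequalities: one by their positions
  in \<open>\<sigma>\<close>, the other by their ranks.\<close>

lemma sum_wt_top_set:
  assumes E: "finite E" and \<sigma>: "\<sigma> \<in> permutations_of_set E" and \<tau>: "\<tau> \<in> permutations_of_set E"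
    and r: "r \<le> card E"
    and mono: "\<And>i j. 1 \<le> i \<Longrightarrow> i \<le> j \<Longrightarrow> j \<le> card E \<Longrightarrow> w i \<ge> w j"
  shows "(\<Sum>e\<in>top_set r (heavier w \<sigma> \<tau>) E. wt w \<sigma> e) = (\<Sum>i=1..r. w i)"
proof -
  let ?hv = "heavier w \<sigma> \<tau>" and ?D = "set (take r \<sigma>)"
  have d: "distinct \<sigma>" "set \<sigma> = E" "length \<sigma> = card E"
    using \<sigma> by (auto simp: permutations_of_set_def distinct_card)
  interpret strict_linear_order E ?hv
    using E \<tau> by (intro strict_linear_order_heavier) (auto simp: permutations_of_set_def)
  have cD: "card ?D = r" using d r by (simp add: distinct_card)
  have "(\<Sum>e\<in>top_set r ?hv E. wt w \<sigma> e) = (\<Sum>e\<in>?D. wt w \<sigma> e)"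
  proof (rule sum_eq_if_const_on_diff)
    show "finite (top_set r ?hv E)" using E by (simp add: top_set_def)
    show "card (top_set r ?hv E) = card ?D" using card_top_set[of E r] r cD by simp
    fix a b assume a: "a \<in> top_set r ?hv E - ?D" and b: "b \<in> ?D - top_set r ?hv E"
    have aE: "a \<in> E" and bE: "b \<in> E" using a b d by (auto simp: top_set_def dest: in_set_takeD)
    have "pos \<sigma> a \<ge> r"
    proof (rule ccontr)
      assume "\<not> ?thesis"
      then have "\<sigma> ! pos \<sigma> a \<in> ?D" using r d by (auto simp: in_set_conv_nth intro!: exI[of _ "pos \<sigma> a"])
      then show False using pos_less_nth(2)[of a \<sigma>] aE d a by auto
    qed
    moreover have "pos \<sigma> b < r"
    proof -
      obtain i where "i < r" "b = \<sigma> ! i" using b r d by (auto simp: in_set_conv_nth)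
      then show ?thesis using pos_nth[OF d(1)] r d by simp
    qed
    moreover have "pos \<sigma> a < card E" using pos_less_nth(1)[of a \<sigma>] aE d by simp
    ultimately have "wt w \<sigma> a \<le> wt w \<sigma> b"
      unfolding wt_def by (intro mono) auto
    moreover have "card {y\<in>E. ?hv y a} < card {y\<in>E. ?hv y b}"
      using a b bE by (auto simp: top_set_def)
    then have "\<not> ?hv b a"
      using rank_strict_mono[of E b a] bE by auto
    then have "wt w \<sigma> b \<le> wt w \<sigma> a"
      by (auto simp: heavier_def)
    ultimately show "wt w \<sigma> a = wt w \<sigma> b" by simp
  qed simp
  then show ?thesis using sum_wt_initial[OF d(1)] r d by simp
qed

section \<open>From selected to accepted elements\<close>

lemma alg_step_selected:
  "alg_step indep r hv \<pi> m t A =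
    (if selected r hv \<pi> m t \<and> indep (insert (\<pi> ! t) A) then insert (\<pi> ! t) A else A)"
  by (auto simp: alg_step_def selected_def Let_def)

lemma sum_alg_ge:
  fixes f :: "'a \<Rightarrow> real"
  assumes mat: "matroid E indep" and \<pi>: "\<pi> \<in> permutations_of_set E" and m: "m \<le> length \<pi>"
    and f: "\<And>e. e \<in> E \<Longrightarrow> 0 \<le> f e"
  shows "(\<Sum>e\<in>alg indep r hv \<pi> m. f e) \<ge>
    (\<Sum>t=m..<length \<pi>. of_bool (selected r hv \<pi> m t) * f (\<pi> ! t)
      * of_bool (\<pi> ! t \<notin> mspan E indep ((!) \<pi> ` {s\<in>{m..<t}. selected r hv \<pi> m s})))"
proof -
  let ?sel = "selected r hv \<pi> m"
  let ?C = "\<lambda>t. (!) \<pi> ` {s\<in>{m..<t}. ?sel s}"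
  define A where "A t = fold (alg_step indep r hv \<pi> m) [m..<t] {}" for t
  have d: "distinct \<pi>" "set \<pi> = E" using \<pi> by (auto simp: permutations_of_set_def)
  have inv: "indep (A t) \<and> A t \<subseteq> ?C t \<and> (\<forall>u\<in>{m..<t}. ?sel u \<and> \<pi> ! u \<notin> mspan E indep (?C u) \<longrightarrow> \<pi> ! u \<in> A t)"
    if "m \<le> t" "t \<le> length \<pi>" for t
    using that
  proof (induction t rule: dec_induct)
    case base
    then show ?case using mat by (simp add: A_def matroid_def)
  next
    case (step t)
    have A: "A (Suc t) = (if ?sel t \<and> indep (insert (\<pi> ! t) (A t)) then insert (\<pi> ! t) (A t) else A t)"
      using step.hyps by (simp add: A_def alg_step_selected)
    have IH: "indep (A t)" "A t \<subseteq> ?C t"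
      "\<And>u. u \<in> {m..<t} \<Longrightarrow> ?sel u \<Longrightarrow> \<pi> ! u \<notin> mspan E indep (?C u) \<Longrightarrow> \<pi> ! u \<in> A t"
      using step by auto
    have C: "?C t \<subseteq> ?C (Suc t)" "?sel t \<Longrightarrow> \<pi> ! t \<in> ?C (Suc t)"
      using step.hyps by auto
    have sub: "A (Suc t) \<subseteq> ?C (Suc t)"
      unfolding A using IH(2) C by (auto simp del: image_subset_iff)
    have "\<pi> ! u \<in> A (Suc t)" if u: "u \<in> {m..<Suc t}" "?sel u" "\<pi> ! u \<notin> mspan E indep (?C u)" for u
    proof (cases "u = t")
      case True
      have "\<pi> ! t \<in> E" using step.prems d by auto
      then have "indep (insert (\<pi> ! t) (A t))"
        using indep_insert_not_mspan[OF mat _ IH(2,1)] u(3) True by blast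
      then show ?thesis using True u(2) by (simp add: A)
    next
      case False
      then have "\<pi> ! u \<in> A t" using IH(3) u by simp
      then show ?thesis by (simp add: A)
    qed
    moreover have "indep (A (Suc t))" using IH(1) by (simp add: A)
    ultimately show ?case using sub by blast
  qed
  let ?n = "length \<pi>"
  let ?I = "{t\<in>{m..<?n}. ?sel t \<and> \<pi> ! t \<notin> mspan E indep (?C t)}"
  have alg: "alg indep r hv \<pi> m = A ?n" by (simp add: alg_def A_def)
  have "(\<Sum>t=m..<?n. of_bool (?sel t) * f (\<pi> ! t) * of_bool (\<pi> ! t \<notin> mspan E indep (?C t)))
     = (\<Sum>t\<in>?I. f (\<pi> ! t))"
    by (intro sum.mono_neutral_cong_right) auto
  also have "\<dots> = (\<Sum>e\<in>(!) \<pi> ` ?I. f e)"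
  proof (rule sum.reindex_cong[symmetric])
    show "inj_on ((!) \<pi>) ?I" using d(1) by (auto simp: inj_on_def nth_eq_iff_index_eq)
  qed auto
  also have "\<dots> \<le> (\<Sum>e\<in>A ?n. f e)"
  proof (rule sum_mono2)
    have ind: "indep (A ?n)" using inv[OF m] by simp
    show "finite (A ?n)" using indep_finite[OF mat ind] .
    show "(!) \<pi> ` ?I \<subseteq> A ?n" using inv[OF m] by blast
    show "0 \<le> f b" if "b \<in> A ?n - (!) \<pi> ` ?I" for b
      using that f indep_carrier[OF mat ind] by blast
  qed
  finally show ?thesis by (simp add: alg)
qed

lemma card_greedy_le_mrank:
  assumes mat: "matroid E indep"
  shows "indep (greedy indep xs)" "card (greedy indep xs) \<le> mrank indep E"
proof -
  have "indep A \<Longrightarrow> indep (fold (\<lambda>e A. if indep (insert e A) then insert e A else A) xs A)" for A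
    by (induction xs arbitrary: A) auto
  then show "indep (greedy indep xs)"
    using mat by (simp add: greedy_def matroid_def)
  then show "card (greedy indep xs) \<le> mrank indep E"
    using card_le_mrank[OF mat] indep_carrier[OF mat] by blast
qed

section \<open>Averaging over relabellings\<close>

lemma map_in_permutations_of_set:
  assumes "\<phi> permutes E" "xs \<in> permutations_of_set E"
  shows "map \<phi> xs \<in> permutations_of_set E"
  using assms by (auto simp: permutations_of_set_def distinct_map permutes_image permutes_inj_on)

lemma sum_permutations_relabel:
  fixes F :: "'a list \<Rightarrow> 'a list \<Rightarrow> 'a list \<Rightarrow> real"
  assumes "\<phi> permutes E"
  defines "P \<equiv> permutations_of_set E"
  shows "(\<Sum>\<sigma>\<in>P. \<Sum>\<tau>\<in>P. \<Sum>\<pi>\<in>P. F (map \<phi> \<sigma>) (map \<phi> \<tau>) (map \<phi> \<pi>))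
    = (\<Sum>\<sigma>\<in>P. \<Sum>\<tau>\<in>P. \<Sum>\<pi>\<in>P. F \<sigma> \<tau> \<pi>)"
proof -
  have one: "(\<Sum>xs\<in>P. G (map \<phi> xs)) = (\<Sum>xs\<in>P. G xs)" for G :: "'a list \<Rightarrow> real"
  proof (rule sum.reindex_bij_witness[where i = "map (inv \<phi>)" and j = "map \<phi>"])
    fix xs assume xs: "xs \<in> P"
    show "map (inv \<phi>) (map \<phi> xs) = xs" "map \<phi> (map (inv \<phi>) xs) = xs"
      using permutes_inv_o[OF assms(1)] by (simp_all only: map_map list.map_id)
    show "map \<phi> xs \<in> P" "map (inv \<phi>) xs \<in> P"
      using xs map_in_permutations_of_set[OF assms(1)] map_in_permutations_of_set[OF permutes_inv[OF assms(1)]]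
      by (auto simp: P_def)
  qed simp
  have "(\<Sum>\<sigma>\<in>P. \<Sum>\<tau>\<in>P. \<Sum>\<pi>\<in>P. F (map \<phi> \<sigma>) (map \<phi> \<tau>) (map \<phi> \<pi>))
     = (\<Sum>\<sigma>\<in>P. \<Sum>\<tau>\<in>P. \<Sum>\<pi>\<in>P. F (map \<phi> \<sigma>) (map \<phi> \<tau>) \<pi>)"
    by (intro sum.cong refl one)
  also have "\<dots> = (\<Sum>\<sigma>\<in>P. \<Sum>\<tau>\<in>P. \<Sum>\<pi>\<in>P. F (map \<phi> \<sigma>) \<tau> \<pi>)"
    by (intro sum.cong refl one)
  also have "\<dots> = (\<Sum>\<sigma>\<in>P. \<Sum>\<tau>\<in>P. \<Sum>\<pi>\<in>P. F \<sigma> \<tau> \<pi>)"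
    by (rule one)
  finally show ?thesis .
qed

text \<open>The product law has finite support, and each of the three uniform permutations
  contributes a factor \<open>1 / fact n\<close>.\<close>

lemma exp_alg_eq:
  assumes E: "finite E" and p: "0 \<le> p" "p \<le> 1"
  defines "P \<equiv> permutations_of_set E" and "n \<equiv> card E"
  shows "exp_alg E indep w p = (\<Sum>m\<le>n. real (n choose m) * p ^ m * (1 - p) ^ (n - m) *
      (\<Sum>\<sigma>\<in>P. \<Sum>\<tau>\<in>P. \<Sum>\<pi>\<in>P.
        \<Sum>e\<in>alg indep (mrank indep E) (heavier w \<sigma> \<tau>) \<pi> m. wt w \<sigma> e)) / fact n ^ 3"
proof -
  let ?V = "\<lambda>m \<sigma> \<tau> \<pi>. \<Sum>e\<in>alg indep (mrank indep E) (heavier w \<sigma> \<tau>) \<pi> m. wt w \<sigma> e"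
  have P: "P \<noteq> {}" "finite P" "card P = fact n"
    using E by (auto simp: P_def n_def)
  have pmf_P: "pmf (pmf_of_set P) x = 1 / fact n" if "x \<in> P" for x
    using that P by simp
  let ?M = "pair_pmf (binomial_pmf n p) (pair_pmf (pmf_of_set P) (pair_pmf (pmf_of_set P) (pmf_of_set P)))"
  have "exp_alg E indep w p = (\<Sum>x\<in>{..n} \<times> P \<times> P \<times> P. (case x of (m, \<sigma>, \<tau>, \<pi>) \<Rightarrow> ?V m \<sigma> \<tau> \<pi>) * pmf ?M x)"
    unfolding exp_alg_def P_def [symmetric] n_def [symmetric]
  proof (rule integral_measure_pmf_real)
    show "finite ({..n} \<times> P \<times> P \<times> P)" using P by simp
    fix x assume "x \<in> set_pmf ?M"
    then show "x \<in> {..n} \<times> P \<times> P \<times> P"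
      using P set_pmf_binomial_eq[of p n] p by (auto split: if_splits)
  qed
  also have "\<dots> = (\<Sum>m\<le>n. \<Sum>\<sigma>\<in>P. \<Sum>\<tau>\<in>P. \<Sum>\<pi>\<in>P.
      (real (n choose m) * p ^ m * (1 - p) ^ (n - m)) * ?V m \<sigma> \<tau> \<pi> / fact n ^ 3)"
    unfolding sum.cartesian_product
    using p by (intro sum.cong) (auto simp: pmf_pair pmf_P power3_eq_cube mult_ac)
  finally show ?thesis
    by (simp add: sum_divide_distrib sum_distrib_left)
qed

text \<open>For fixed permutations, a relabelling keeps the selected times and the weights at those
  times, but spreads the selected elements uniformly over \<open>E\<close>. Then
  \<open>card_permutations_not_mspan\<close>, with \<open>C\<close> the elements selected earlier,
  bounds the chance of acceptance.\<close>

lemma sum_alg_average_ge: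
  assumes mat: "matroid E indep" and "loopless E indep" "uniformly_dense E indep"
    and r: "r = mrank indep E" "r \<ge> 1" and m: "m \<le> card E"
    and w: "\<And>i. 1 \<le> i \<Longrightarrow> i \<le> card E \<Longrightarrow> w i \<ge> 0"
  defines "P \<equiv> permutations_of_set E"
  shows "(\<Sum>\<sigma>\<in>P. \<Sum>\<tau>\<in>P. \<Sum>\<pi>\<in>P. \<Sum>e\<in>alg indep r (heavier w \<sigma> \<tau>) \<pi> m. wt w \<sigma> e) \<ge>
    (\<Sum>\<sigma>\<in>P. \<Sum>\<tau>\<in>P. \<Sum>\<pi>\<in>P. \<Sum>t=m..<card E.
       of_bool (selected r (heavier w \<sigma> \<tau>) \<pi> m t) * wt w \<sigma> (\<pi> ! t)
        * (1 - real (card {s\<in>{m..<t}. selected r (heavier w \<sigma> \<tau>) \<pi> m s}) / real r))"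
proof -
  let ?n = "card E"
  let ?V = "\<lambda>\<sigma> \<tau> \<pi>. \<Sum>e\<in>alg indep r (heavier w \<sigma> \<tau>) \<pi> m. wt w \<sigma> e"
  let ?sel = "\<lambda>\<sigma> \<tau> \<pi> t. selected r (heavier w \<sigma> \<tau>) \<pi> m t"
  let ?I = "\<lambda>\<sigma> \<tau> \<pi> t. {s\<in>{m..<t}. ?sel \<sigma> \<tau> \<pi> s}"
  let ?\<Phi> = "{\<phi>. \<phi> permutes E}"
  have finE: "finite E" by (rule finite_E[OF mat])
  have d: "distinct \<pi>" "set \<pi> = E" "length \<pi> = ?n" if "\<pi> \<in> P" for \<pi>
    using that by (auto simp: P_def permutations_of_set_def distinct_card)
  have wt_nonneg: "wt w \<sigma> e \<ge> 0" if "\<sigma> \<in> P" "e \<in> E" for \<sigma> e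
    using pos_less_nth(1)[of e \<sigma>] d[OF that(1)] that(2) w[of "pos \<sigma> e + 1"] by (simp add: wt_def)
  have relabel: "?V (map \<phi> \<sigma>) (map \<phi> \<tau>) (map \<phi> \<pi>) \<ge> (\<Sum>t=m..<?n. of_bool (?sel \<sigma> \<tau> \<pi> t)
      * wt w \<sigma> (\<pi> ! t) * of_bool (\<phi> (\<pi> ! t) \<notin> mspan E indep (\<phi> ` ((!) \<pi> ` ?I \<sigma> \<tau> \<pi> t))))"
    if \<phi>: "\<phi> permutes E" and "\<sigma> \<in> P" "\<tau> \<in> P" "\<pi> \<in> P" for \<phi> \<sigma> \<tau> \<pi>
  proof -
    let ?hv' = "heavier w (map \<phi> \<sigma>) (map \<phi> \<tau>)"
    have inj: "inj \<phi>" using \<phi> by (rule permutes_inj)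
    have mapP: "map \<phi> \<sigma> \<in> P" "map \<phi> \<pi> \<in> P"
      using that map_in_permutations_of_set by (auto simp: P_def)
    have sel: "selected r ?hv' (map \<phi> \<pi>) m t = ?sel \<sigma> \<tau> \<pi> t" if "t < ?n" for t
      using that d(3)[OF \<open>\<pi> \<in> P\<close>] by (intro selected_map[OF inj] heavier_map[OF inj]) simp
    have C: "(!) (map \<phi> \<pi>) ` {s\<in>{m..<t}. selected r ?hv' (map \<phi> \<pi>) m s} = \<phi> ` ((!) \<pi> ` ?I \<sigma> \<tau> \<pi> t)"
      if "t < ?n" for t
    proof -
      have "{s\<in>{m..<t}. selected r ?hv' (map \<phi> \<pi>) m s} = ?I \<sigma> \<tau> \<pi> t"
        using sel that by auto
      then show ?thesis
        using that d(3)[OF \<open>\<pi> \<in> P\<close>] by (simp only: image_image) (intro image_cong, auto)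
    qed
    have "?V (map \<phi> \<sigma>) (map \<phi> \<tau>) (map \<phi> \<pi>) \<ge> (\<Sum>t=m..<length (map \<phi> \<pi>). of_bool (selected r ?hv' (map \<phi> \<pi>) m t)
      * wt w (map \<phi> \<sigma>) (map \<phi> \<pi> ! t)
      * of_bool (map \<phi> \<pi> ! t \<notin> mspan E indep ((!) (map \<phi> \<pi>) ` {s\<in>{m..<t}. selected r ?hv' (map \<phi> \<pi>) m s})))"
      using mapP d[OF \<open>\<pi> \<in> P\<close>] m wt_nonneg by (intro sum_alg_ge[OF mat]) (auto simp: P_def)
    also have "(\<Sum>t=m..<length (map \<phi> \<pi>). of_bool (selected r ?hv' (map \<phi> \<pi>) m t)
      * wt w (map \<phi> \<sigma>) (map \<phi> \<pi> ! t)
      * of_bool (map \<phi> \<pi> ! t \<notin> mspan E indep ((!) (map \<phi> \<pi>) ` {s\<in>{m..<t}. selected r ?hv' (map \<phi> \<pi>) m s})))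
      = (\<Sum>t=m..<?n. of_bool (?sel \<sigma> \<tau> \<pi> t)
      * wt w \<sigma> (\<pi> ! t) * of_bool (\<phi> (\<pi> ! t) \<notin> mspan E indep (\<phi> ` ((!) \<pi> ` ?I \<sigma> \<tau> \<pi> t))))"
    proof (rule sum.cong)
      fix t assume "t \<in> {m..<?n}"
      then have t: "t < ?n" by simp
      then have nth: "map \<phi> \<pi> ! t = \<phi> (\<pi> ! t)" using d(3)[OF \<open>\<pi> \<in> P\<close>] by simp
      show "of_bool (selected r ?hv' (map \<phi> \<pi>) m t) * wt w (map \<phi> \<sigma>) (map \<phi> \<pi> ! t)
          * of_bool (map \<phi> \<pi> ! t \<notin> mspan E indep ((!) (map \<phi> \<pi>) ` {s\<in>{m..<t}. selected r ?hv' (map \<phi> \<pi>) m s}))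
        = of_bool (?sel \<sigma> \<tau> \<pi> t) * wt w \<sigma> (\<pi> ! t)
          * of_bool (\<phi> (\<pi> ! t) \<notin> mspan E indep (\<phi> ` ((!) \<pi> ` ?I \<sigma> \<tau> \<pi> t)))"
        unfolding sel[OF t] C[OF t] nth wt_map[OF inj] ..
    qed (use d(3)[OF \<open>\<pi> \<in> P\<close>] in simp)
    finally show ?thesis .
  qed
  have average: "(\<Sum>\<phi>\<in>?\<Phi>. ?V (map \<phi> \<sigma>) (map \<phi> \<tau>) (map \<phi> \<pi>))
     \<ge> fact ?n * (\<Sum>t=m..<?n. of_bool (?sel \<sigma> \<tau> \<pi> t) * wt w \<sigma> (\<pi> ! t) * (1 - real (card (?I \<sigma> \<tau> \<pi> t)) / real r))"
    if "\<sigma> \<in> P" "\<tau> \<in> P" "\<pi> \<in> P" for \<sigma> \<tau> \<pi>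
  proof -
    let ?C = "\<lambda>t. (!) \<pi> ` ?I \<sigma> \<tau> \<pi> t"
    have "fact ?n * (\<Sum>t=m..<?n. of_bool (?sel \<sigma> \<tau> \<pi> t) * wt w \<sigma> (\<pi> ! t) * (1 - real (card (?I \<sigma> \<tau> \<pi> t)) / real r))
      = (\<Sum>t=m..<?n. of_bool (?sel \<sigma> \<tau> \<pi> t) * wt w \<sigma> (\<pi> ! t) * (fact ?n * (1 - real (card (?I \<sigma> \<tau> \<pi> t)) / real r)))"
      unfolding sum_distrib_left by (intro sum.cong) (simp_all add: mult_ac)
    also have "\<dots> \<le> (\<Sum>t=m..<?n. of_bool (?sel \<sigma> \<tau> \<pi> t) * wt w \<sigma> (\<pi> ! t)
        * (\<Sum>\<phi>\<in>?\<Phi>. of_bool (\<phi> (\<pi> ! t) \<notin> mspan E indep (\<phi> ` ?C t))))"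
    proof (intro sum_mono mult_left_mono)
      fix t assume t: "t \<in> {m..<?n}"
      have inj: "inj_on ((!) \<pi>) {..<?n}"
        using d[OF that(3)] by (auto simp: inj_on_def nth_eq_iff_index_eq)
      have "inj_on ((!) \<pi>) (?I \<sigma> \<tau> \<pi> t)"
        using t by (intro inj_on_subset[OF inj]) auto
      then have cC: "card (?C t) = card (?I \<sigma> \<tau> \<pi> t)"
        by (rule card_image)
      have CE: "?C t \<subseteq> E" and tE: "\<pi> ! t \<in> E" using d[OF that(3)] t by auto
      moreover have "\<pi> ! t \<notin> ?C t"
        using d[OF that(3)] t by (auto simp: nth_eq_iff_index_eq)
      ultimately show "fact ?n * (1 - real (card (?I \<sigma> \<tau> \<pi> t)) / real r)
        \<le> (\<Sum>\<phi>\<in>?\<Phi>. of_bool (\<phi> (\<pi> ! t) \<notin> mspan E indep (\<phi> ` ?C t)))"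
        using card_permutations_not_mspan[OF mat assms(2,3) _ CE, of "\<pi> ! t"] r cC by simp
      show "0 \<le> of_bool (?sel \<sigma> \<tau> \<pi> t) * wt w \<sigma> (\<pi> ! t)"
        using wt_nonneg[OF that(1) tE] by simp
    qed
    also have "\<dots> = (\<Sum>\<phi>\<in>?\<Phi>. \<Sum>t=m..<?n. of_bool (?sel \<sigma> \<tau> \<pi> t) * wt w \<sigma> (\<pi> ! t)
        * of_bool (\<phi> (\<pi> ! t) \<notin> mspan E indep (\<phi> ` ?C t)))"
      unfolding sum_distrib_left by (rule sum.swap)
    also have "\<dots> \<le> (\<Sum>\<phi>\<in>?\<Phi>. ?V (map \<phi> \<sigma>) (map \<phi> \<tau>) (map \<phi> \<pi>))"
      using relabel that by (intro sum_mono) auto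
    finally show ?thesis .
  qed
  let ?R = "\<lambda>\<sigma> \<tau> \<pi>. \<Sum>t=m..<?n. of_bool (?sel \<sigma> \<tau> \<pi> t) * wt w \<sigma> (\<pi> ! t) * (1 - real (card (?I \<sigma> \<tau> \<pi> t)) / real r)"
  \<comment> \<open>The pointwise bounds are summed over all inputs. Every relabelling permutes the
    inputs, so the upper bound consists of \<open>fact n\<close> copies of one sum and this factor
    cancels.\<close>
  have "fact ?n * (\<Sum>\<sigma>\<in>P. \<Sum>\<tau>\<in>P. \<Sum>\<pi>\<in>P. ?R \<sigma> \<tau> \<pi>) = (\<Sum>\<sigma>\<in>P. \<Sum>\<tau>\<in>P. \<Sum>\<pi>\<in>P. fact ?n * ?R \<sigma> \<tau> \<pi>)"
    by (simp only: sum_distrib_left)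
  also have "\<dots> \<le> (\<Sum>\<sigma>\<in>P. \<Sum>\<tau>\<in>P. \<Sum>\<pi>\<in>P. \<Sum>\<phi>\<in>?\<Phi>. ?V (map \<phi> \<sigma>) (map \<phi> \<tau>) (map \<phi> \<pi>))"
    using average by (intro sum_mono)
  also have "\<dots> = (\<Sum>\<phi>\<in>?\<Phi>. \<Sum>\<sigma>\<in>P. \<Sum>\<tau>\<in>P. \<Sum>\<pi>\<in>P. ?V (map \<phi> \<sigma>) (map \<phi> \<tau>) (map \<phi> \<pi>))"
    by (simp only: sum.swap[where A = ?\<Phi>])
  also have "\<dots> = (\<Sum>\<phi>\<in>?\<Phi>. \<Sum>\<sigma>\<in>P. \<Sum>\<tau>\<in>P. \<Sum>\<pi>\<in>P. ?V \<sigma> \<tau> \<pi>)"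
    unfolding P_def by (intro sum.cong refl sum_permutations_relabel) simp
  also have "\<dots> = fact ?n * (\<Sum>\<sigma>\<in>P. \<Sum>\<tau>\<in>P. \<Sum>\<pi>\<in>P. ?V \<sigma> \<tau> \<pi>)"
    by (simp add: card_permutations[OF refl finE])
  finally show ?thesis by simp
qed

text \<open>Keeps only the arrivals among the \<open>r\<close> heaviest elements of
  \<open>E\<close>, whose weights add up to \<open>w 1 + ... + w r\<close>, and groups them by
  element and time.\<close>

lemma sum_selected_weight_ge:
  fixes p :: real
  assumes E: "finite E" and r: "1 \<le> r" "r \<le> card E" and p: "0 \<le> p" "p \<le> 1"
    and mono: "\<And>i j. 1 \<le> i \<Longrightarrow> i \<le> j \<Longrightarrow> j \<le> card E \<Longrightarrow> w i \<ge> w j"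
    and w: "\<And>i. 1 \<le> i \<Longrightarrow> i \<le> card E \<Longrightarrow> w i \<ge> 0"
    and \<sigma>: "\<sigma> \<in> permutations_of_set E" and \<tau>: "\<tau> \<in> permutations_of_set E"
  shows "(\<Sum>\<pi>\<in>permutations_of_set E. \<Sum>t=m..<card E.
       of_bool (selected r (heavier w \<sigma> \<tau>) \<pi> m t) * wt w \<sigma> (\<pi> ! t)
        * (1 - real (card {s\<in>{m..<t}. selected r (heavier w \<sigma> \<tau>) \<pi> m s}) / real r))
    \<ge> (\<Sum>i=1..r. w i) * fact (card E - 1)
      * (\<Sum>s=m..<card E. 2 * p * (if s = 0 then 1 else real m / real s) - p\<^sup>2)"
proof -
  let ?P = "permutations_of_set E" and ?n = "card E" and ?hv = "heavier w \<sigma> \<tau>"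
  let ?Top = "top_set r ?hv E"
  let ?c = "\<lambda>s. 2 * p * (if s = 0 then 1 else real m / real s) - p\<^sup>2"
  let ?X = "\<lambda>\<pi> t. of_bool (selected r ?hv \<pi> m t)
     * (1 - real (card (top_set r ?hv (set (take t \<pi>)) - set (take m \<pi>))) / real r)"
  have d: "distinct \<pi>" "set \<pi> = E" "length \<pi> = ?n" if "\<pi> \<in> ?P" for \<pi>
    using that by (auto simp: permutations_of_set_def distinct_card)
  interpret strict_linear_order E ?hv
    using E d(2)[OF \<tau>] by (rule strict_linear_order_heavier)
  have wt_nonneg: "wt w \<sigma> e \<ge> 0" if "e \<in> E" for e
    using pos_less_nth(1)[of e \<sigma>] d[OF \<sigma>] that w[of "pos \<sigma> e + 1"] by (simp add: wt_def)
  have Top: "?Top \<subseteq> E" by (auto simp: top_set_def)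
  have Wt: "(\<Sum>e\<in>?Top. wt w \<sigma> e) = (\<Sum>i=1..r. w i)"
    by (intro sum_wt_top_set E \<sigma> \<tau> r(2) mono)
  have X_nonneg: "?X \<pi> t \<ge> 0" if "\<pi> \<in> ?P" for \<pi> t
  proof -
    have sub: "set (take t \<pi>) \<subseteq> E" using d(2)[OF that] by (auto dest: in_set_takeD)
    have "card (top_set r ?hv (set (take t \<pi>)) - set (take m \<pi>)) \<le> card (top_set r ?hv (set (take t \<pi>)))"
      by (intro card_mono) (auto simp: top_set_def)
    also have "\<dots> \<le> r" using card_top_set[OF sub, of r] by simp
    finally show ?thesis using r by simp
  qed
  have "(\<Sum>i=1..r. w i) * fact (?n - 1) * (\<Sum>s=m..<?n. ?c s)
    = (\<Sum>e\<in>?Top. wt w \<sigma> e * (\<Sum>s=m..<?n. ?c s * fact (?n - 1)))"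
    unfolding sum_distrib_right [symmetric] Wt by (simp only: mult_ac)
  also have "\<dots> \<le> (\<Sum>e\<in>?Top. wt w \<sigma> e * (\<Sum>s=m..<?n. \<Sum>\<pi> | \<pi> \<in> ?P \<and> \<pi> ! s = e. ?X \<pi> s))"
    using wt_nonneg Top p by (intro sum_mono mult_left_mono selected_sum_ge[OF r(1)]) auto
  also have "\<dots> = (\<Sum>e\<in>?Top. \<Sum>s=m..<?n. \<Sum>\<pi>\<in>?P. of_bool (\<pi> ! s = e) * (wt w \<sigma> e * ?X \<pi> s))"
    unfolding sum_distrib_left
    by (intro sum.cong refl sum.mono_neutral_cong_left) auto
  also have "\<dots> = (\<Sum>\<pi>\<in>?P. \<Sum>s=m..<?n. \<Sum>e\<in>?Top. of_bool (\<pi> ! s = e) * (wt w \<sigma> e * ?X \<pi> s))"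
    by (subst sum.swap, subst sum.swap[where A = ?Top], subst sum.swap) (rule refl)
  \<comment> \<open>Arrivals outside the global top set are added; their terms are
    nonnegative.\<close>
  also have "\<dots> \<le> (\<Sum>\<pi>\<in>?P. \<Sum>s=m..<?n. wt w \<sigma> (\<pi> ! s) * ?X \<pi> s)"
  proof (intro sum_mono)
    fix \<pi> s assume \<pi>: "\<pi> \<in> ?P" and s: "s \<in> {m..<?n}"
    have "\<pi> ! s \<in> E" using d[OF \<pi>] s by auto
    then have nn: "0 \<le> wt w \<sigma> (\<pi> ! s) * ?X \<pi> s"
      by (rule mult_nonneg_nonneg[OF wt_nonneg X_nonneg[OF \<pi>]])
    have "finite ?Top" using Top E finite_subset by blast
    then have "(\<Sum>e\<in>?Top. of_bool (\<pi> ! s = e) * (wt w \<sigma> e * ?X \<pi> s))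
       = of_bool (\<pi> ! s \<in> ?Top) * (wt w \<sigma> (\<pi> ! s) * ?X \<pi> s)"
      using sum.delta[of ?Top "\<pi> ! s" "\<lambda>e. wt w \<sigma> e * ?X \<pi> s"]
      by (simp add: of_bool_def if_distrib[where f = "\<lambda>x. x * _"] eq_commute cong: if_cong)
    also have "\<dots> \<le> wt w \<sigma> (\<pi> ! s) * ?X \<pi> s"
      using nn by (cases "\<pi> ! s \<in> ?Top") simp_all
    finally show "(\<Sum>e\<in>?Top. of_bool (\<pi> ! s = e) * (wt w \<sigma> e * ?X \<pi> s)) \<le> wt w \<sigma> (\<pi> ! s) * ?X \<pi> s" .
  qed
  \<comment> \<open>There are at most as many earlier selections as elements of \<open>T\<close>
    from outside the sample, so replacing the latter count by the former only increases each
    term.\<close>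
  also have "\<dots> \<le> (\<Sum>\<pi>\<in>?P. \<Sum>t=m..<?n. of_bool (selected r ?hv \<pi> m t) * wt w \<sigma> (\<pi> ! t)
        * (1 - real (card {s\<in>{m..<t}. selected r ?hv \<pi> m s}) / real r))"
  proof (intro sum_mono)
    fix \<pi> t assume \<pi>: "\<pi> \<in> ?P" and t: "t \<in> {m..<?n}"
    have tE: "\<pi> ! t \<in> E" using d[OF \<pi>] t by auto
    have "card {s\<in>{m..<t}. selected r ?hv \<pi> m s} \<le> card (top_set r ?hv (set (take t \<pi>)) - set (take m \<pi>))"
      using t d[OF \<pi>] r by (intro card_selected_le) auto
    then have "1 - real (card (top_set r ?hv (set (take t \<pi>)) - set (take m \<pi>))) / real r
      \<le> 1 - real (card {s\<in>{m..<t}. selected r ?hv \<pi> m s}) / real r"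
      by (intro diff_left_mono divide_right_mono) auto
    then have "of_bool (selected r ?hv \<pi> m t) * wt w \<sigma> (\<pi> ! t)
       * (1 - real (card (top_set r ?hv (set (take t \<pi>)) - set (take m \<pi>))) / real r)
      \<le> of_bool (selected r ?hv \<pi> m t) * wt w \<sigma> (\<pi> ! t)
        * (1 - real (card {s\<in>{m..<t}. selected r ?hv \<pi> m s}) / real r)"
      using wt_nonneg[OF tE] by (intro mult_left_mono) auto
    then show "wt w \<sigma> (\<pi> ! t) * ?X \<pi> t \<le> of_bool (selected r ?hv \<pi> m t) * wt w \<sigma> (\<pi> ! t)
        * (1 - real (card {s\<in>{m..<t}. selected r ?hv \<pi> m s}) / real r)"
      by (simp only: mult_ac)
  qed
  finally show ?thesis .
qed

section \<open>Expected weights of the algorithm and of the optimum\<close>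

lemma exp_alg_ge:
  fixes p :: real
  assumes mat: "matroid E indep" and "loopless E indep" "uniformly_dense E indep"
    and r: "r = mrank indep E" "r \<ge> 1" and p: "0 < p" "p < 1"
    and mono: "\<And>i j. 1 \<le> i \<Longrightarrow> i \<le> j \<Longrightarrow> j \<le> card E \<Longrightarrow> w i \<ge> w j"
    and w: "\<And>i. 1 \<le> i \<Longrightarrow> i \<le> card E \<Longrightarrow> w i \<ge> 0"
  shows "exp_alg E indep w p \<ge> (- p\<^sup>2 * ln p) * (\<Sum>i=1..r. w i)"
proof -
  let ?P = "permutations_of_set E" and ?n = "card E" and ?W = "\<Sum>i=1..r. w i"
  let ?b = "\<lambda>m. real (?n choose m) * p ^ m * (1 - p) ^ (?n - m)"
  let ?c = "\<lambda>m. \<Sum>s=m..<?n. 2 * p * (if s = 0 then 1 else real m / real s) - p\<^sup>2"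
  let ?V = "\<lambda>m. \<Sum>\<sigma>\<in>?P. \<Sum>\<tau>\<in>?P. \<Sum>\<pi>\<in>?P. \<Sum>e\<in>alg indep r (heavier w \<sigma> \<tau>) \<pi> m. wt w \<sigma> e"
  have finE: "finite E" by (rule finite_E[OF mat])
  have rn: "r \<le> ?n" using mrank_le_card[OF mat finE] r by simp
  have W: "?W \<ge> 0" using w rn by (intro sum_nonneg) auto
  have V: "?V m \<ge> fact ?n ^ 2 * (?W * fact (?n - 1) * ?c m)" if m: "m \<le> ?n" for m
  proof -
    have "fact ?n ^ 2 * (?W * fact (?n - 1) * ?c m) = (\<Sum>\<sigma>\<in>?P. \<Sum>\<tau>\<in>?P. ?W * fact (?n - 1) * ?c m)"
      using finE by (simp add: power2_eq_square)
    also have "\<dots> \<le> (\<Sum>\<sigma>\<in>?P. \<Sum>\<tau>\<in>?P. \<Sum>\<pi>\<in>?P. \<Sum>t=m..<?n.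
       of_bool (selected r (heavier w \<sigma> \<tau>) \<pi> m t) * wt w \<sigma> (\<pi> ! t)
        * (1 - real (card {s\<in>{m..<t}. selected r (heavier w \<sigma> \<tau>) \<pi> m s}) / real r))"
      using p by (intro sum_mono sum_selected_weight_ge finE r(2) rn mono w) auto
    also have "\<dots> \<le> ?V m"
      by (intro sum_alg_average_ge mat assms(2,3) r m w)
    finally show ?thesis .
  qed
  \<comment> \<open>The product of \<open>n\<close> and \<open>fact (n - 1)\<close> supplies one of
    the three factors \<open>fact n\<close> of the normalisation; the other two come from the sums
    over \<open>\<sigma>\<close> and \<open>\<tau>\<close>.\<close>
  have "(- p\<^sup>2 * ln p) * ?W = real ?n * (- p\<^sup>2 * ln p) * (fact ?n ^ 2 * ?W * fact (?n - 1)) / fact ?n ^ 3"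
  proof -
    have "fact ?n ^ 3 = fact ?n ^ 2 * (real ?n * fact (?n - 1))"
      using rn r(2) by (simp add: fact_reduce[of ?n] power3_eq_cube power2_eq_square)
    moreover have "fact ?n ^ 3 \<noteq> (0::real)" by simp
    ultimately show ?thesis by (simp add: nonzero_eq_divide_eq)
  qed
  also have "\<dots> \<le> (\<Sum>m\<le>?n. ?b m * ?c m) * (fact ?n ^ 2 * ?W * fact (?n - 1)) / fact ?n ^ 3"
    using binomial_quadratic_ge[OF p, of ?n] rn r(2) W
    by (intro divide_right_mono mult_right_mono) auto
  also have "\<dots> = (\<Sum>m\<le>?n. ?b m * (fact ?n ^ 2 * (?W * fact (?n - 1) * ?c m))) / fact ?n ^ 3"
  proof -
    have "x * c * (f * W * g) = x * (f * (W * g * c))" for x c f W g :: real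
      by simp
    then show ?thesis by (simp only: sum_distrib_right [of "\<lambda>m. ?b m * ?c m"])
  qed
  also have "\<dots> \<le> (\<Sum>m\<le>?n. ?b m * ?V m) / fact ?n ^ 3"
    using V p by (intro divide_right_mono sum_mono mult_left_mono) auto
  also have "\<dots> = exp_alg E indep w p"
    using exp_alg_eq[OF finE, of p indep w] p r(1) by simp
  finally show ?thesis .
qed

text \<open>The greedy set has at most as many elements as the rank \<open>r\<close>. Those beyond
  the first \<open>r\<close> positions of \<open>\<sigma>\<close> are mapped injectively to unchosen
  elements at these positions, which are at least as heavy.\<close>

lemma exp_opt_le:
  assumes mat: "matroid E indep"
    and mono: "\<And>i j. 1 \<le> i \<Longrightarrow> i \<le> j \<Longrightarrow> j \<le> card E \<Longrightarrow> w i \<ge> w j"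
    and w: "\<And>i. 1 \<le> i \<Longrightarrow> i \<le> card E \<Longrightarrow> w i \<ge> 0"
  shows "exp_opt E indep w \<le> (\<Sum>i=1..mrank indep E. w i)"
proof -
  let ?P = "permutations_of_set E" and ?r = "mrank indep E"
  have finE: "finite E" by (rule finite_E[OF mat])
  have rn: "?r \<le> card E" using mrank_le_card[OF mat finE] .
  have bound: "(\<Sum>e\<in>greedy indep \<sigma>. wt w \<sigma> e) \<le> (\<Sum>i=1..?r. w i)" if \<sigma>: "\<sigma> \<in> ?P" for \<sigma>
  proof -
    have d: "distinct \<sigma>" "set \<sigma> = E" "length \<sigma> = card E"
      using \<sigma> by (auto simp: permutations_of_set_def distinct_card)
    let ?G = "greedy indep \<sigma>" and ?D = "set (take ?r \<sigma>)"
    have G: "?G \<subseteq> E" "card ?G \<le> ?r"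
      using card_greedy_le_mrank[OF mat] indep_carrier[OF mat] by auto
    have finG: "finite ?G" using G(1) finE by (rule finite_subset)
    have cD: "card ?D = ?r" using d rn by (simp add: distinct_card)
    have pos_D: "e \<in> ?D \<longleftrightarrow> pos \<sigma> e < ?r" if "e \<in> E" for e
    proof
      assume "e \<in> ?D"
      then obtain i where "i < ?r" "e = \<sigma> ! i" using rn d by (auto simp: in_set_conv_nth)
      then show "pos \<sigma> e < ?r" using pos_nth[OF d(1)] rn d by simp
    next
      assume "pos \<sigma> e < ?r"
      then show "e \<in> ?D"
        using pos_less_nth[of e \<sigma>] that d by (auto simp: in_set_conv_nth intro!: exI[of _ "pos \<sigma> e"])
    qed
    have DE: "?D \<subseteq> E" using d by (auto dest: in_set_takeD)
    have cd: "card (?G - ?D) \<le> card (?D - ?G)"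
      using G(2) cD finG by (simp add: card_Diff_subset_Int Int_commute diff_le_mono)
    then obtain h where h: "inj_on h (?G - ?D)" "h ` (?G - ?D) \<subseteq> ?D - ?G"
      using card_le_inj[of "?G - ?D" "?D - ?G"] finG by auto
    have "wt w \<sigma> e \<le> wt w \<sigma> (h e)" if e: "e \<in> ?G - ?D" for e
    proof -
      have "e \<in> E" "h e \<in> E" "h e \<in> ?D" using e h(2) G(1) DE by auto
      then have "pos \<sigma> (h e) < ?r" "?r \<le> pos \<sigma> e" "pos \<sigma> e < card E"
        using pos_D e pos_less_nth(1)[of e \<sigma>] d by auto
      then show ?thesis unfolding wt_def by (intro mono) auto
    qed
    then have "(\<Sum>e\<in>?G - ?D. wt w \<sigma> e) \<le> (\<Sum>e\<in>?G - ?D. wt w \<sigma> (h e))"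
      by (intro sum_mono) auto
    also have "\<dots> = (\<Sum>e\<in>h ` (?G - ?D). wt w \<sigma> e)"
      using sum.reindex[OF h(1), of "wt w \<sigma>"] by simp
    also have "\<dots> \<le> (\<Sum>e\<in>?D - ?G. wt w \<sigma> e)"
    proof (rule sum_mono2)
      fix b assume "b \<in> ?D - ?G - h ` (?G - ?D)"
      then have "b \<in> E" using DE by auto
      then show "0 \<le> wt w \<sigma> b"
        using pos_less_nth(1)[of b \<sigma>] d w[of "pos \<sigma> b + 1"] by (simp add: wt_def)
    qed (use h(2) in auto)
    finally have "(\<Sum>e\<in>?G. wt w \<sigma> e) \<le> (\<Sum>e\<in>?D. wt w \<sigma> e)"
      using finG sum.Int_Diff[of ?G "wt w \<sigma>" ?D] sum.Int_Diff[of ?D "wt w \<sigma>" ?G]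
      by (simp add: Int_commute)
    also have "\<dots> = (\<Sum>i=1..?r. w i)"
      using sum_wt_initial[OF d(1)] d rn by simp
    finally show ?thesis .
  qed
  have "exp_opt E indep w = (\<Sum>\<sigma>\<in>?P. \<Sum>e\<in>greedy indep \<sigma>. wt w \<sigma> e) / real (card ?P)"
    unfolding exp_opt_def using finE by (intro integral_pmf_of_set) auto
  also have "\<dots> \<le> (\<Sum>\<sigma>\<in>?P. \<Sum>i=1..?r. w i) / real (card ?P)"
    using bound by (intro divide_right_mono sum_mono) auto
  also have "\<dots> = (\<Sum>i=1..?r. w i)" using finE by simp
  finally show ?thesis .
qed

theorem theorem2:
  fixes E :: "'a set" and indep :: "'a set \<Rightarrow> bool" and w :: "nat \<Rightarrow> real"
    and n r :: nat and p :: real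
  assumes "matroid E indep" and "loopless E indep" and "uniformly_dense E indep"
    and "n = card E" and "r = mrank indep E" and "r \<ge> 1"
    and "0 < p" and "p < 1"
    and "\<And>i j. 1 \<le> i \<Longrightarrow> i \<le> j \<Longrightarrow> j \<le> n \<Longrightarrow> w i \<ge> w j"
    and "\<And>i. 1 \<le> i \<Longrightarrow> i \<le> n \<Longrightarrow> w i \<ge> 0"
  shows "exp_alg E indep w p \<ge> (- p\<^sup>2 * ln p) * (\<Sum>i=1..r. w i)
    \<and> (- p\<^sup>2 * ln p) * (\<Sum>i=1..r. w i) \<ge> (- p\<^sup>2 * ln p) * exp_opt E indep w
    \<and> 2 * exp 1 * exp_alg E indep w (exp (- 1 / 2)) \<ge> exp_opt E indep w"
proof -
  let ?W = "\<Sum>i=1..r. w i"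
  have alg: "exp_alg E indep w q \<ge> (- q\<^sup>2 * ln q) * ?W" if "0 < q" "q < 1" for q
    using assms that by (intro exp_alg_ge) auto
  have opt: "exp_opt E indep w \<le> ?W"
    using exp_opt_le[of E indep w] assms by simp
  have "- p\<^sup>2 * ln p \<ge> 0"
    using assms(7,8) by (simp add: mult_nonneg_nonpos)
  then have 2: "(- p\<^sup>2 * ln p) * ?W \<ge> (- p\<^sup>2 * ln p) * exp_opt E indep w"
    using opt by (rule mult_left_mono[rotated])
  \<comment> \<open>At \<open>p = exp (- 1 / 2)\<close> the square \<open>p\<^sup>2\<close> is
    \<open>1 / exp 1\<close> and \<open>- ln p\<close> is \<open>1 / 2\<close>.\<close>
  have "(- (exp (- 1 / 2))\<^sup>2 * ln (exp (- 1 / 2))) = (1 / (2 * exp 1) :: real)"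
  proof -
    have "(exp (- 1 / 2))\<^sup>2 = (exp (- 1) :: real)"
      using exp_double[of "- 1 / 2 :: real"] by simp
    then show ?thesis
      by (simp only: ln_exp) (simp add: exp_minus divide_simps)
  qed
  then have "?W / (2 * exp 1) \<le> exp_alg E indep w (exp (- 1 / 2))"
    using alg[of "exp (- 1 / 2)"] by simp
  then have "?W \<le> 2 * exp 1 * exp_alg E indep w (exp (- 1 / 2))"
    by (simp add: field_simps)
  then show ?thesis using alg[OF assms(7,8)] 2 opt by linarith
qed

end
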